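(* Let $N\ge1$, $s\in(0,\frac12)$, $\frac{1}{1-s}<p<2$, and let $\Omega\subset\mathbb{R}^N$ be a bounded open set which is convex in the $x_N$ direction and symmetric with respect to the hyperplane $\{x_N=0\}$. Assume that $f\in C^{0,1}_{loc}(\mathbb{R})$ and that $u\in W_0^{s,p}(\Omega)\cap C(\mathbb{R}^N)$ is a non-negative weak solution of $$\begin{cases}(-\Delta)_p^su=f(u) & \text{in }\Omega,\\ u=0 & \text{in }\mathbb{R}^N\setminus\Omega.\end{cases}$$ Then $u$ is symmetric with respect to the hyperplane $\{x_N=0\}$, i.e. $u(x',-x_N)=u(x',x_N)$ for all $(x',x_N)\in\mathbb{R}^{N-1}\times\mathbb{R}$.
   Context: Points are written $x=(x',x_N)\in\mathbb{R}^{N-1}\times\mathbb{R}$. "Convex in the $x_N$ direction" means that any segment parallel to the $x_N$-axis with endpoints in $\Omega$ is contained in $\Omega$. $C^{0,1}_{loc}$ denotes locally Lipschitz functions. Function spaces: $[u]_{s,p}=\left(\int_{\mathbb{R}^N}\int_{\mathbb{R}^N}\frac{|u(x)-u(y)|^p}{|x-y|^{N+sp}}\,dx\,dy\right)^{1/p}$; $W^{s,p}(\mathbb{R}^N)=\{u\in L^p(\mathbb{R}^N):[u]_{s,p}<\infty\}$ with norm $\|u\|_{L^p(\mathbb{R}^N)}+[u]_{s,p}$; $W^{s,p}_0(\Omega)=\{u\in W^{s,p}(\mathbb{R}^N): u=0 \text{ a.e. in } \mathbb{R}^N\setminus\Omega\}$, with dual space $W_0^{s,p}(\Omega)'$. Weak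 solution: $u\in W_0^{s,p}(\Omega)$ is a weak solution if $f(u)\in W_0^{s,p}(\Omega)'$ and $$\int_{\mathbb{R}^N}\int_{\mathbb{R}^N}\frac{|u(x)-u(y)|^{p-2}(u(x)-u(y))(\varphi(x)-\varphi(y))}{|x-y|^{N+sp}}\,dx\,dy=\langle f(u),\varphi\rangle\qquad\forall\,\varphi\in W_0^{s,p}(\Omega),$$ where $f(u)$ acts by $\langle f(u),\varphi\rangle=\int_\Omega f(u)\varphi\,dx$. *)

theory Defs
  imports "HOL-Analysis.Analysis"
begin

text \<open>
  The space \<open>real ^ 'n\<close> has dimension \<open>CARD('n) \<ge> 1\<close>. A fixed index \<open>k :: 'n\<close> plays the role of
  the last coordinate, so that \<open>x $ k\<close> is the coordinate written \<open>x\<^sub>N\<close> and the remaining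
  components form \<open>x'\<close>.
\<close>

definition refl_coord :: "'n::finite \<Rightarrow> real ^ 'n \<Rightarrow> real ^ 'n" where
  "refl_coord k x = (\<chi> i. if i = k then - (x $ i) else x $ i)"

definition convex_in_direction :: "'n::finite \<Rightarrow> (real ^ 'n) set \<Rightarrow> bool" where
  "convex_in_direction k \<Omega> \<longleftrightarrow>
     (\<forall>x\<in>\<Omega>. \<forall>y\<in>\<Omega>. (\<forall>i. i \<noteq> k \<longrightarrow> x $ i = y $ i) \<longrightarrow> closed_segment x y \<subseteq> \<Omega>)"

text \<open>The library notion concerns families of functions; here the family is constant.\<close>

definition locally_lipschitz :: "(real \<Rightarrow> real) \<Rightarrow> bool" where
  "locally_lipschitz f \<longleftrightarrow> local_lipschitz (UNIV :: real set) UNIV (\<lambda>_. f)"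

text \<open>
  Functions are Lebesgue measurable representatives; they are not quotiented by equality almost
  everywhere. On the diagonal \<open>x = y\<close> the quotients below take the value \<open>0 / 0 = 0\<close>; the
  diagonal is a null set.
\<close>

definition Lp_fun :: "real \<Rightarrow> (real ^ 'n::finite \<Rightarrow> real) set" where
  "Lp_fun p = {u \<in> borel_measurable lebesgue. integrable lebesgue (\<lambda>x. \<bar>u x\<bar> powr p)}"

definition Lp_norm :: "real \<Rightarrow> (real ^ 'n::finite \<Rightarrow> real) \<Rightarrow> real" where
  "Lp_norm p u = (LINT x|lebesgue. \<bar>u x\<bar> powr p) powr (1 / p)"

definition gagliardo_energy :: "real \<Rightarrow> real \<Rightarrow> (real ^ 'n::finite \<Rightarrow> real) \<Rightarrow> ennreal" where
  "gagliardo_energy s p u =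
     (\<integral>\<^sup>+ y. \<integral>\<^sup>+ x. ennreal (\<bar>u x - u y\<bar> powr p / norm (x - y) powr (real CARD('n) + s * p))
        \<partial>lebesgue \<partial>lebesgue)"

text \<open>The value of the seminorm is meaningful only when the energy is finite.\<close>

definition gagliardo_seminorm :: "real \<Rightarrow> real \<Rightarrow> (real ^ 'n::finite \<Rightarrow> real) \<Rightarrow> real" where
  "gagliardo_seminorm s p u = enn2real (gagliardo_energy s p u) powr (1 / p)"

definition Wsp :: "real \<Rightarrow> real \<Rightarrow> (real ^ 'n::finite \<Rightarrow> real) set" where
  "Wsp s p = {u \<in> Lp_fun p. gagliardo_energy s p u < \<infinity>}"

definition Wsp_norm :: "real \<Rightarrow> real \<Rightarrow> (real ^ 'n::finite \<Rightarrow> real) \<Rightarrow> real" where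
  "Wsp_norm s p u = Lp_norm p u + gagliardo_seminorm s p u"

definition Wsp0 :: "real \<Rightarrow> real \<Rightarrow> (real ^ 'n::finite) set \<Rightarrow> (real ^ 'n \<Rightarrow> real) set" where
  "Wsp0 s p \<Omega> = {u \<in> Wsp s p. AE x in lebesgue. x \<notin> \<Omega> \<longrightarrow> u x = 0}"

text \<open>
  Continuous linear functionals, given by their values on representatives; boundedness makes them
  respect equality almost everywhere. Values outside \<open>Wsp0 s p \<Omega>\<close> are irrelevant.
\<close>

definition Wsp0_dual ::
    "real \<Rightarrow> real \<Rightarrow> (real ^ 'n::finite) set \<Rightarrow> ((real ^ 'n \<Rightarrow> real) \<Rightarrow> real) set" where
  "Wsp0_dual s p \<Omega> = {l.
     (\<forall>\<phi>\<in>Wsp0 s p \<Omega>. \<forall>\<psi>\<in>Wsp0 s p \<Omega>. l (\<lambda>x. \<phi> x + \<psi> x) = l \<phi> + l \<psi>) \<and>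
     (\<forall>c. \<forall>\<phi>\<in>Wsp0 s p \<Omega>. l (\<lambda>x. c * \<phi> x) = c * l \<phi>) \<and>
     (\<exists>C. \<forall>\<phi>\<in>Wsp0 s p \<Omega>. \<bar>l \<phi>\<bar> \<le> C * Wsp_norm s p \<phi>)}"

definition pairing ::
    "(real ^ 'n::finite) set \<Rightarrow> (real ^ 'n \<Rightarrow> real) \<Rightarrow> (real ^ 'n \<Rightarrow> real) \<Rightarrow> real" where
  "pairing \<Omega> g \<phi> = (LINT x:\<Omega>|lebesgue. g x * \<phi> x)"

text \<open>
  A function \<open>g\<close> on \<open>\<Omega>\<close> belongs to the dual space when its pairing is defined on all of
  \<open>Wsp0 s p \<Omega>\<close> (the Bochner integral of a non-integrable function is \<open>0\<close>, so integrability has to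
  be required) and is continuous there.
\<close>

definition acts_in_dual ::
    "real \<Rightarrow> real \<Rightarrow> (real ^ 'n::finite) set \<Rightarrow> (real ^ 'n \<Rightarrow> real) \<Rightarrow> bool" where
  "acts_in_dual s p \<Omega> g \<longleftrightarrow>
     (\<forall>\<phi>\<in>Wsp0 s p \<Omega>. set_integrable lebesgue \<Omega> (\<lambda>x. g x * \<phi> x)) \<and>
     pairing \<Omega> g \<in> Wsp0_dual s p \<Omega>"

text \<open>
  For \<open>u\<close> and \<open>\<phi>\<close> in \<open>Wsp s p\<close> the integrand is absolutely integrable by Hoelder's inequality.
  Where \<open>u x = u y\<close> the factor \<open>0 powr (p - 2) * 0\<close> is \<open>0\<close>, also for \<open>p < 2\<close>.
\<close>

definition frac_p_form ::
    "real \<Rightarrow> real \<Rightarrow> (real ^ 'n::finite \<Rightarrow> real) \<Rightarrow> (real ^ 'n \<Rightarrow> real) \<Rightarrow> real" where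
  "frac_p_form s p u \<phi> =
     (LINT y|lebesgue. LINT x|lebesgue.
        \<bar>u x - u y\<bar> powr (p - 2) * (u x - u y) * (\<phi> x - \<phi> y)
          / norm (x - y) powr (real CARD('n) + s * p))"

text \<open>
  Weak solutions of \<open>(-\<Delta>)\<^sub>p\<^sup>s u = f(u)\<close> in \<open>\<Omega>\<close> with \<open>u = 0\<close> outside \<open>\<Omega>\<close>; the exterior condition
  is the membership in \<open>Wsp0 s p \<Omega>\<close>.
\<close>

definition weak_solution ::
    "real \<Rightarrow> real \<Rightarrow> (real ^ 'n::finite) set \<Rightarrow> (real \<Rightarrow> real) \<Rightarrow> (real ^ 'n \<Rightarrow> real) \<Rightarrow> bool" where
  "weak_solution s p \<Omega> f u \<longleftrightarrow>
     u \<in> Wsp0 s p \<Omega> \<and>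
     acts_in_dual s p \<Omega> (\<lambda>x. f (u x)) \<and>
     (\<forall>\<phi>\<in>Wsp0 s p \<Omega>. frac_p_form s p u \<phi> = pairing \<Omega> (\<lambda>x. f (u x)) \<phi>)"

end

theory Submission
  imports Defs
begin

text \<open>
  The proof moves hyperplanes orthogonal to the \<open>k\<close>-th axis from infinity towards the centre. Let
  \<open>e\<close> be one of the two unit vectors of that axis, let \<open>T\<close> be the reflection in
  \<open>{x. x \<bullet> e = l}\<close> with \<open>l \<ge> 0\<close>, and put \<open>w = u - u \<circ> T\<close>. The goal is \<open>w \<le> 0\<close> on the cap
  \<open>{x. x \<bullet> e > l}\<close> for every \<open>l \<ge> 0\<close>; at \<open>l = 0\<close>, for \<open>e\<close> and for \<open>- e\<close>, this is the symmetry.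

  The equation is tested with the odd function \<open>\<phi>\<close> that equals \<open>w\<^sup>+\<close> on the cap. It vanishes
  off the domain because the cap of the domain is reflected into the domain, and it has finite energy
  (\<open>odd_test_energy_le\<close>). With \<open>G t = \<bar>t\<bar> powr (p - 2) * t\<close>, folding the double integral onto the
  cap pairs the kernel \<open>K(x, y)\<close> with the smaller kernel \<open>K(x, T y)\<close>. Since \<open>p < 2\<close> and \<open>u\<close> is
  bounded, \<open>G\<close> increases at a rate bounded from below by a constant \<open>c > 0\<close> on all occurring
  differences. Hence the folded integrand is at least
  \<open>c \<phi>(x) [(K(x, y) - K(x, T y)) w\<^sup>-(y) + 2 K(x, T y) \<phi>(x)]\<close> (\<open>spow_reflection_ineq\<close>,
  \<open>form_odd_test_ge\<close>). As \<open>f\<close> is Lipschitz on the range of \<open>u\<close>, the right-hand side of the equation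
  is at most \<open>L \<integral> \<phi>\<^sup>2\<close> over the cap (\<open>reaction_odd_test_le\<close>). So \<open>\<phi>\<close> vanishes as soon as, pointwise
  in \<open>x\<close>, the \<open>y\<close>-integral of the bracket beats a multiple of \<open>L \<phi>(x)\<close>
  (\<open>gap_nonpos_if_coercive\<close>).

  Two effects provide this. At distance \<open>d\<close> from the hyperplane, \<open>\<integral> K(x, T y) dy\<close> is of order
  \<open>d powr (- s p)\<close>, so the second summand suffices for small \<open>d\<close>. Away from the hyperplane the
  integral of the first summand is bounded below by a positive constant once \<open>w < 0\<close> somewhere, and it
  suffices because \<open>\<phi>\<close> is uniformly small when the hyperplane is close to a level at which \<open>w \<le> 0\<close>. Thus a
  level \<open>l > 0\<close> with \<open>w \<le> 0\<close>, not identically zero, can be lowered (\<open>plane_moves_past\<close>). The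
  kernel is positive between any two points, so zeros of \<open>u\<close> and disconnected domains do no harm.

  It remains to exclude that \<open>w\<close> vanishes identically at a level \<open>l > 0\<close> while \<open>u\<close> is nonzero. Then
  \<open>u\<close> would vanish on an open part of the domain lying below, in direction \<open>e\<close>, the whole set
  \<open>{u > 0}\<close>. There the equation says that the potential \<open>\<integral> u(y) powr (p - 1) K(x, y) dy\<close> is constant,
  whereas it strictly decreases as \<open>x\<close> moves away in direction \<open>- e\<close>
  (\<open>not_symmetric_about_positive\<close>).
\<close>

section \<open>Reflections and Lebesgue measure\<close>

definition mirror :: "'a::euclidean_space \<Rightarrow> real \<Rightarrow> 'a \<Rightarrow> 'a" where
  "mirror e l x = x - (2 * (x \<bullet> e - l)) *\<^sub>R e"

lemma inner_mirror: "norm e = 1 \<Longrightarrow> mirror e l x \<bullet> e = 2 * l - x \<bullet> e"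
  by (simp add: mirror_def inner_diff_left algebra_simps dot_square_norm)

lemma mirror_mirror [simp]: "norm e = 1 \<Longrightarrow> mirror e l (mirror e l x) = x"
  by (subst mirror_def) (simp add: inner_mirror, simp add: mirror_def algebra_simps)

lemma continuous_on_mirror [continuous_intros]:
  "continuous_on A g \<Longrightarrow> continuous_on A (\<lambda>x. mirror e l (g x))"
  unfolding mirror_def by (intro continuous_intros)

lemma borel_measurable_mirror [measurable]: "mirror e l \<in> borel_measurable borel"
  by (intro borel_measurable_continuous_onI continuous_intros)

text \<open>
  This identity is the geometric source of every comparison between \<open>K(x, y)\<close> and \<open>K(x, T y)\<close>: the
  second distance exceeds the first by an amount given by the distances to the hyperplane.
\<close>

lemma norm_diff_mirror_sq:
  assumes "norm e = 1"
  shows "(norm (x - mirror e l y))\<^sup>2 = (norm (x - y))\<^sup>2 + 4 * (x \<bullet> e - l) * (y \<bullet> e - l)"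
proof -
  have "e \<bullet> e = 1" using assms by (simp add: dot_square_norm)
  then show ?thesis
    unfolding mirror_def power2_norm_eq_inner
    by (simp add: inner_simps inner_commute algebra_simps)
qed

lemma norm_mirror_diff:
  assumes "norm e = 1"
  shows "norm (mirror e l x - mirror e l y) = norm (x - y)"
proof -
  have "(norm (mirror e l x - mirror e l y))\<^sup>2 = (norm (x - y))\<^sup>2"
    using norm_diff_mirror_sq[OF assms, of "mirror e l x" l y]
      norm_diff_mirror_sq[OF assms, of y l x]
    by (simp add: inner_mirror assms norm_minus_commute algebra_simps)
  then show ?thesis by simp
qed

lemma norm_mirror_swap: "norm e = 1 \<Longrightarrow> norm (mirror e l x - y) = norm (x - mirror e l y)"
  by (metis norm_mirror_diff mirror_mirror)

lemma norm_diff_mirror_ge: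
  assumes "norm e = 1" "x \<bullet> e \<ge> l" "y \<bullet> e \<ge> l"
  shows "norm (x - y) \<le> norm (x - mirror e l y)"
proof (rule power2_le_imp_le)
  show "(norm (x - y))\<^sup>2 \<le> (norm (x - mirror e l y))\<^sup>2"
    unfolding norm_diff_mirror_sq[OF assms(1)] using assms by simp
qed simp

text \<open>
  For a coordinate direction the reflection is a diagonal affine map with entries of modulus one.
\<close>

lemma distr_lborel_mirror_Basis:
  fixes e :: "'a::euclidean_space"
  assumes e: "e \<in> Basis"
  shows "distr lborel borel (mirror e l) = lborel"
proof -
  define c where "c j = (if j = e then - 1 else 1 :: real)" for j :: 'a
  have "mirror e l x = (2 * l) *\<^sub>R e + (\<Sum>j\<in>Basis. (c j * (x \<bullet> j)) *\<^sub>R j)" for x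
  proof -
    have "(\<Sum>j\<in>Basis. (c j * (x \<bullet> j)) *\<^sub>R j)
        = (\<Sum>j\<in>Basis. (x \<bullet> j) *\<^sub>R j - (if j = e then (2 * (x \<bullet> e)) *\<^sub>R e else 0))"
      by (intro sum.cong) (auto simp: c_def scaleR_2 simp flip: scaleR_left_distrib scaleR_minus_left scaleR_left_diff_distrib)
    also have "\<dots> = x - (2 * (x \<bullet> e)) *\<^sub>R e"
      using e by (simp add: sum_subtractf euclidean_representation)
    finally show ?thesis by (simp add: mirror_def algebra_simps)
  qed
  moreover have "(\<Prod>j\<in>Basis. \<bar>c j\<bar>) = 1" by (intro prod.neutral) (simp add: c_def)
  moreover have "c j \<noteq> 0" for j by (simp add: c_def)
  ultimately show ?thesis
    using lborel_affine_euclidean[of c "(2 * l) *\<^sub>R e"]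
    by (simp add: density_1 flip: ennreal_1 cong: distr_cong) (metis ext density_1 ennreal_1)
qed

lemma distr_lborel_mirror:
  fixes e :: "'a::euclidean_space"
  assumes "e \<in> Basis \<or> - e \<in> Basis"
  shows "distr lborel borel (mirror e l) = lborel"
proof -
  have "mirror e l = mirror (- e) (- l)" by (auto simp: mirror_def algebra_simps)
  then show ?thesis using assms distr_lborel_mirror_Basis[of e l] distr_lborel_mirror_Basis[of "- e" "- l"] by auto
qed

abbreviation lborel2 :: "('a::euclidean_space \<times> 'a) measure" where
  "lborel2 \<equiv> lborel \<Otimes>\<^sub>M lborel"

lemma distr_pair_lborel:
  fixes f g :: "'a::euclidean_space \<Rightarrow> 'a"
  assumes [measurable]: "f \<in> borel_measurable borel" "g \<in> borel_measurable borel"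
    and "distr lborel borel f = lborel" "distr lborel borel g = lborel"
  shows "distr lborel2 lborel2 (\<lambda>(x, y). (f x, g y)) = lborel2"
proof -
  have eq: "distr lborel lborel f = lborel" "distr lborel lborel g = lborel"
    using assms(3,4) by (metis distr_cong sets_lborel)+
  have "sigma_finite_measure (distr lborel lborel g)" unfolding eq by (rule sigma_finite_lborel)
  from pair_measure_distr[of f lborel lborel g lborel lborel, OF _ _ this]
  show ?thesis by (simp add: eq)
qed

lemma pair_lborel_map:
  fixes f g :: "'a::euclidean_space \<Rightarrow> 'a" and F :: "'a \<times> 'a \<Rightarrow> real"
  assumes [measurable]: "f \<in> borel_measurable borel" "g \<in> borel_measurable borel"
    and d: "distr lborel borel f = lborel" "distr lborel borel g = lborel"
    and [measurable]: "F \<in> borel_measurable lborel2"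
  shows "integrable lborel2 F \<Longrightarrow> integrable lborel2 (\<lambda>z. F (f (fst z), g (snd z)))"
    and "(LINT z|lborel2. F (f (fst z), g (snd z))) = (LINT z|lborel2. F z)"
proof -
  let ?M = "lborel2 :: ('a \<times> 'a) measure"
  let ?h = "\<lambda>z. (f (fst z), g (snd z))"
  have [measurable]: "?h \<in> measurable ?M ?M" by measurable
  have D: "distr ?M ?M ?h = ?M"
    using distr_pair_lborel[OF assms(1,2) d] by (simp add: case_prod_beta')
  show "integrable ?M F \<Longrightarrow> integrable ?M (\<lambda>z. F (?h z))"
    using integrable_distr_eq[of ?h ?M ?M F] unfolding D by simp
  show "(LINT z|?M. F (?h z)) = (LINT z|?M. F z)"
    using integral_distr[of ?h ?M ?M F] unfolding D by simp
qed

lemma pair_lborel_swap: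
  fixes F :: "'a::euclidean_space \<times> 'a \<Rightarrow> real"
  assumes [measurable]: "F \<in> borel_measurable lborel2"
  shows "(LINT z|lborel2. F (snd z, fst z)) = (LINT z|lborel2. F z)"
    and "integrable lborel2 F \<Longrightarrow> integrable lborel2 (\<lambda>z. F (snd z, fst z))"
  using lborel_pair.integral_product_swap[of F] lborel_pair.integrable_product_swap[of F]
  by (simp_all add: case_prod_beta')

lemma integral_lborel_map:
  fixes F :: "'a::euclidean_space \<Rightarrow> real"
  assumes [measurable]: "f \<in> borel_measurable borel" and d: "distr lborel borel f = lborel"
    and [measurable]: "F \<in> borel_measurable borel"
  shows "(LINT x|lborel. F (f x)) = (LINT x|lborel. F x)"
  using integral_distr[of f lborel borel F] unfolding d by simp

lemma AE_lborel_map: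
  fixes f :: "'a::euclidean_space \<Rightarrow> 'a"
  assumes [measurable]: "f \<in> borel_measurable borel" and d: "distr lborel borel f = lborel"
    and "AE x in lborel. P x"
  shows "AE x in lborel. P (f x)"
proof -
  have "f \<in> lborel \<rightarrow>\<^sub>M lborel" by simp
  from AE_distrD[OF this] show ?thesis using assms(3) d
    by (metis distr_cong sets_lborel)
qed

text \<open>
  Nonempty open sets have positive measure; for continuous functions this upgrades statements that
  hold almost everywhere to pointwise ones.
\<close>

lemma AE_open_imp_empty:
  fixes S :: "'a::euclidean_space set"
  assumes "open S" "AE x in lborel. x \<notin> S"
  shows "S = {}"
proof (rule ccontr)
  assume "S \<noteq> {}"
  have "S \<in> null_sets lborel"
    using assms by (simp add: AE_iff_null_sets borel_open)
  then have "S \<in> null_sets lebesgue" by (rule null_sets_completionI)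
  then have "negligible S" by (simp add: negligible_iff_null_sets)
  then show False using open_not_negligible[OF assms(1) \<open>S \<noteq> {}\<close>] by simp
qed

lemma nn_integral_ge_on_set:
  assumes B: "B \<in> sets M" and d: "\<And>y. y \<in> B \<Longrightarrow> ennreal d \<le> F y"
  shows "ennreal d * emeasure M B \<le> (\<integral>\<^sup>+y. F y \<partial>M)"
proof -
  have "ennreal d * emeasure M B = (\<integral>\<^sup>+y. ennreal d * indicator B y \<partial>M)"
    using B by (simp add: nn_integral_cmult_indicator)
  also have "\<dots> \<le> (\<integral>\<^sup>+y. F y \<partial>M)"
    by (intro nn_integral_mono) (auto simp: indicator_def d)
  finally show ?thesis .
qed

section \<open>Kernel and signed power\<close>

text \<open>
  On the diagonal the kernel has the value \<open>1 / 0 = 0\<close>, so that \<open>ker q x y\<close> decreases in the distance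
  only for \<open>x \<noteq> y\<close>.
\<close>

definition ker :: "real \<Rightarrow> 'a::real_normed_vector \<Rightarrow> 'a \<Rightarrow> real" where
  "ker q x y = 1 / norm (x - y) powr q"

definition spow :: "real \<Rightarrow> real \<Rightarrow> real" where
  "spow p t = \<bar>t\<bar> powr (p - 2) * t"

lemma ker_nonneg [simp]: "0 \<le> ker q x y"
  by (simp add: ker_def)

lemma ker_commute: "ker q x y = ker q y x"
  by (simp add: ker_def norm_minus_commute)

lemma spow_0 [simp]: "spow p 0 = 0"
  by (simp add: spow_def)

lemma spow_minus [simp]: "spow p (- t) = - spow p t"
  by (simp add: spow_def)

lemma borel_measurable_ker [measurable]:
  fixes f g :: "'b \<Rightarrow> 'a::euclidean_space"
  assumes [measurable]: "f \<in> borel_measurable M" "g \<in> borel_measurable M"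
  shows "(\<lambda>x. ker q (f x) (g x)) \<in> borel_measurable M"
  unfolding ker_def by measurable

lemma borel_measurable_spow [measurable]:
  assumes [measurable]: "f \<in> borel_measurable M"
  shows "(\<lambda>x. spow p (f x)) \<in> borel_measurable M"
  unfolding spow_def by measurable

lemma spow_nonneg: "0 \<le> t \<Longrightarrow> spow p t = t powr (p - 1)"
proof (cases "t = 0")
  case False
  assume "0 \<le> t"
  with False have "t powr (p - 2) * t powr 1 = t powr (p - 1)"
    by (subst powr_add[symmetric]) simp
  then show ?thesis using \<open>0 \<le> t\<close> by (simp add: spow_def)
qed simp

lemma abs_spow: "\<bar>spow p t\<bar> = \<bar>t\<bar> powr (p - 1)"
  using spow_nonneg[of "\<bar>t\<bar>" p] by (simp add: spow_def abs_mult)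

lemma spow_diff_ge_nonneg:
  assumes p: "1 < p" "p < 2" and ab: "0 \<le> b" "b \<le> a" "a \<le> M" and M: "0 < M"
  shows "spow p a - spow p b \<ge> (p - 1) * M powr (p - 2) * (a - b)"
proof (cases "b = a")
  case False
  then have lt: "b < a" using ab by simp
  have "continuous_on {b..a} (\<lambda>t. t powr (p - 1))"
    using p ab by (intro continuous_on_powr' continuous_intros) auto
  moreover have "((\<lambda>t. t powr (p - 1)) has_derivative (*) ((p - 1) * t powr (p - 2))) (at t)" if "b < t" "t < a" for t
    using that ab has_real_derivative_powr[of t "p - 1"] by (simp add: has_field_derivative_def)
  ultimately obtain t where t: "b < t" "t < a"
     "a powr (p - 1) - b powr (p - 1) = (p - 1) * t powr (p - 2) * (a - b)"
    using mvt[OF lt, of "\<lambda>t. t powr (p - 1)" "\<lambda>t. (*) ((p - 1) * t powr (p - 2))"] by auto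
  have "M powr (p - 2) \<le> t powr (p - 2)"
    using t ab p by (intro powr_mono2') auto
  then show ?thesis
    using t ab p by (auto simp: spow_nonneg intro!: mult_right_mono mult_left_mono)
qed simp

text \<open>
  The derivative of the signed power at \<open>t\<close> is \<open>(p - 1) * \<bar>t\<bar> powr (p - 2)\<close>. Because \<open>p < 2\<close>, it is
  smallest at the largest \<open>\<bar>t\<bar>\<close>. This turns the singular operator into a uniformly elliptic one on
  bounded functions. The mean value theorem applies on either side of the origin, where the derivative
  does not exist, and the two parts add up.
\<close>

lemma spow_diff_ge:
  assumes p: "1 < p" "p < 2" and ab: "\<bar>a\<bar> \<le> M" "\<bar>b\<bar> \<le> M" "b \<le> a" and M: "0 < M"
  shows "spow p a - spow p b \<ge> (p - 1) * M powr (p - 2) * (a - b)"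
proof -
  consider "0 \<le> b" | "a \<le> 0" | "b \<le> 0" "0 \<le> a" by linarith
  then show ?thesis
  proof cases
    case 1 then show ?thesis using spow_diff_ge_nonneg[OF p, of b a M] ab M by simp
  next
    case 2
    then show ?thesis using spow_diff_ge_nonneg[OF p, of "-a" "-b" M] ab M by (simp add: algebra_simps)
  next
    case 3
    then show ?thesis using spow_diff_ge_nonneg[OF p, of 0 a M] spow_diff_ge_nonneg[OF p, of 0 "-b" M] ab M
      by (simp add: algebra_simps)
  qed
qed

lemma spow_mono:
  assumes "1 < p" "p < 2" "b \<le> a" shows "spow p b \<le> spow p a"
proof -
  define M where "M = \<bar>a\<bar> + \<bar>b\<bar> + 1"
  have "0 \<le> (p - 1) * M powr (p - 2) * (a - b)" using assms by simp
  also have "\<dots> \<le> spow p a - spow p b"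
    by (rule spow_diff_ge) (use assms in \<open>auto simp: M_def\<close>)
  finally show ?thesis by simp
qed

section \<open>Energy, form and pairing as Borel integrals\<close>

definition energy_density :: "real \<Rightarrow> real \<Rightarrow> ('a::euclidean_space \<Rightarrow> real) \<Rightarrow> 'a \<times> 'a \<Rightarrow> real" where
  "energy_density p q u z = \<bar>u (fst z) - u (snd z)\<bar> powr p * ker q (fst z) (snd z)"

definition form_density ::
    "real \<Rightarrow> real \<Rightarrow> ('a::euclidean_space \<Rightarrow> real) \<Rightarrow> ('a \<Rightarrow> real) \<Rightarrow> 'a \<times> 'a \<Rightarrow> real" where
  "form_density p q u \<phi> z =
     spow p (u (fst z) - u (snd z)) * (\<phi> (fst z) - \<phi> (snd z)) * ker q (fst z) (snd z)"

lemma energy_density_nonneg [simp]: "0 \<le> energy_density p q u z"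
  by (simp add: energy_density_def)

lemma borel_measurable_energy_density [measurable]:
  assumes [measurable]: "u \<in> borel_measurable borel"
  shows "energy_density p q u \<in> borel_measurable lborel2"
  unfolding energy_density_def by measurable

lemma borel_measurable_form_density [measurable]:
  assumes [measurable]: "u \<in> borel_measurable borel" "\<phi> \<in> borel_measurable borel"
  shows "form_density p q u \<phi> \<in> borel_measurable lborel2"
  unfolding form_density_def by measurable

lemma integrable_energy_density_iff:
  assumes [measurable]: "u \<in> borel_measurable borel"
  shows "integrable lborel2 (energy_density p q u) \<longleftrightarrow>
    (\<integral>\<^sup>+z. ennreal (energy_density p q u z) \<partial>lborel2) < \<infinity>"
  by (simp add: integrable_iff_bounded)

lemma gagliardo_energy_eq:
  fixes u :: "real ^ 'n::finite \<Rightarrow> real"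
  assumes [measurable]: "u \<in> borel_measurable borel"
  shows "gagliardo_energy s p u =
    (\<integral>\<^sup>+z. ennreal (energy_density p (real CARD('n) + s * p) u z) \<partial>lborel2)"
proof -
  let ?q = "real CARD('n) + s * p"
  have "gagliardo_energy s p u =
      (\<integral>\<^sup>+ y. \<integral>\<^sup>+ x. ennreal (energy_density p ?q u (y, x)) \<partial>lborel \<partial>lborel)"
    by (simp add: gagliardo_energy_def nn_integral_completion energy_density_def ker_def
        norm_minus_commute abs_minus_commute)
  also have "\<dots> = (\<integral>\<^sup>+z. ennreal (energy_density p ?q u z) \<partial>lborel2)"
    by (rule lborel.nn_integral_fst) measurable
  finally show ?thesis .
qed

lemma Wsp0_iff:
  fixes u :: "real ^ 'n::finite \<Rightarrow> real"
  assumes [measurable]: "u \<in> borel_measurable borel"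
  shows "u \<in> Wsp0 s p \<Omega> \<longleftrightarrow>
    integrable lborel (\<lambda>x. \<bar>u x\<bar> powr p) \<and>
    integrable lborel2 (energy_density p (real CARD('n) + s * p) u) \<and>
    (AE x in lborel. x \<notin> \<Omega> \<longrightarrow> u x = 0)"
proof -
  have "u \<in> borel_measurable lebesgue" by (simp add: measurable_completion)
  then show ?thesis
    by (auto simp: Wsp0_def Wsp_def Lp_fun_def integrable_energy_density_iff gagliardo_energy_eq
        integrable_completion AE_completion_iff)
qed

text \<open>
  The larger of the two moduli dominates both factors.
\<close>

lemma abs_spow_mult_le:
  assumes "1 < p"
  shows "\<bar>spow p a * b\<bar> \<le> \<bar>a\<bar> powr p + \<bar>b\<bar> powr p"
proof -
  define m where "m = max \<bar>a\<bar> \<bar>b\<bar>"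
  have "\<bar>spow p a * b\<bar> \<le> m powr (p - 1) * m"
    unfolding abs_mult abs_spow using assms
    by (intro mult_mono powr_mono2) (auto simp: m_def)
  also have "\<dots> = m powr p"
    by (cases "m = 0") (auto simp: powr_diff m_def)
  also have "\<dots> \<le> \<bar>a\<bar> powr p + \<bar>b\<bar> powr p"
    by (auto simp: m_def max_def)
  finally show ?thesis .
qed

lemma integrable_form_density:
  fixes u \<phi> :: "'a::euclidean_space \<Rightarrow> real"
  assumes [measurable]: "u \<in> borel_measurable borel" "\<phi> \<in> borel_measurable borel"
    and p: "1 < p"
    and "integrable lborel2 (energy_density p q u)" "integrable lborel2 (energy_density p q \<phi>)"
  shows "integrable lborel2 (form_density p q u \<phi>)"
proof (rule Bochner_Integration.integrable_bound)
  show "integrable lborel2 (\<lambda>z. energy_density p q u z + energy_density p q \<phi> z)"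
    using assms by simp
  show "AE z in lborel2. norm (form_density p q u \<phi> z)
      \<le> norm (energy_density p q u z + energy_density p q \<phi> z)"
  proof (intro AE_I2)
    fix z :: "'a \<times> 'a"
    have "norm (form_density p q u \<phi> z) \<le> energy_density p q u z + energy_density p q \<phi> z"
      using mult_right_mono[OF abs_spow_mult_le[OF p, of "u (fst z) - u (snd z)" "\<phi> (fst z) - \<phi> (snd z)"],
          OF ker_nonneg[of q "fst z" "snd z"]]
      by (simp add: form_density_def energy_density_def abs_mult distrib_right)
    then show "norm (form_density p q u \<phi> z) \<le> norm (energy_density p q u z + energy_density p q \<phi> z)"
      by simp
  qed
qed measurable

text \<open>
  Both sides integrate the same symmetric function, once iteratedly for Lebesgue measure and once over
  the product of Borel measures.
\<close>

lemma frac_p_form_eq: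
  fixes u \<phi> :: "real ^ 'n::finite \<Rightarrow> real" and s p :: real
  defines "q \<equiv> real CARD('n) + s * p"
  assumes [measurable]: "u \<in> borel_measurable borel" "\<phi> \<in> borel_measurable borel"
    and "integrable lborel2 (form_density p q u \<phi>)"
  shows "frac_p_form s p u \<phi> = (LINT z|lborel2. form_density p q u \<phi> z)"
proof -
  let ?g = "\<lambda>y x. form_density p q u \<phi> (y, x)"
  have sym: "\<bar>u x - u y\<bar> powr (p - 2) * (u x - u y) * (\<phi> x - \<phi> y)
          / norm (x - y) powr (real CARD('n) + s * p) = ?g y x" for x y
    by (simp add: form_density_def ker_def q_def spow_def norm_minus_commute abs_minus_commute)
       (simp add: algebra_simps)
  have [measurable]: "case_prod ?g \<in> borel_measurable lborel2" by simp
  have "frac_p_form s p u \<phi> = (LINT y|lebesgue. LINT x|lborel. ?g y x)"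
    unfolding frac_p_form_def sym by (simp add: integral_completion)
  also have "\<dots> = (LINT y|lborel. LINT x|lborel. ?g y x)"
    by (rule integral_completion) measurable
  also have "\<dots> = (LINT z|lborel2. form_density p q u \<phi> z)"
    using lborel_pair.integral_fst'[OF assms(4)] .
  finally show ?thesis .
qed

lemma pairing_eq:
  fixes g \<phi> :: "real ^ 'n::finite \<Rightarrow> real"
  assumes [measurable]: "g \<in> borel_measurable borel" "\<phi> \<in> borel_measurable borel" "\<Omega> \<in> sets borel"
    and "AE x in lborel. x \<notin> \<Omega> \<longrightarrow> \<phi> x = 0"
  shows "pairing \<Omega> g \<phi> = (LINT x|lborel. g x * \<phi> x)"
proof -
  have "pairing \<Omega> g \<phi> = (LINT x|lborel. indicator \<Omega> x *\<^sub>R (g x * \<phi> x))"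
    unfolding pairing_def set_lebesgue_integral_def by (rule integral_completion) measurable
  also have "\<dots> = (LINT x|lborel. g x * \<phi> x)"
    by (rule integral_cong_AE) (use assms(4) in \<open>auto elim!: eventually_mono simp: indicator_def\<close>)
  finally show ?thesis .
qed

lemma integrable_bounded_support:
  fixes f :: "'a::euclidean_space \<Rightarrow> real"
  assumes [measurable]: "f \<in> borel_measurable borel"
    and "\<And>x. \<bar>f x\<bar> \<le> B" and "\<And>x. R < norm x \<Longrightarrow> f x = 0"
  shows "integrable lborel f"
proof (rule Bochner_Integration.integrable_bound)
  show "integrable lborel (\<lambda>x. B * indicator (cball (0::'a) R) x)"
    by (intro integrable_mult_right integrable_real_indicator)
       (use emeasure_bounded_finite[of "cball (0::'a) R"] in auto)
  show "AE x in lborel. norm (f x) \<le> norm (B * indicator (cball (0::'a) R) x)"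
  proof (intro AE_I2)
    fix x
    show "norm (f x) \<le> norm (B * indicator (cball (0::'a) R) x)"
      using assms(2)[of x] assms(3)[of x] by (cases "norm x \<le> R") auto
  qed
qed simp

lemma energy_density_isometry:
  fixes u :: "'a::euclidean_space \<Rightarrow> real" and T :: "'a \<Rightarrow> 'a"
  assumes [measurable]: "u \<in> borel_measurable borel" "T \<in> borel_measurable borel"
    and d: "distr lborel borel T = lborel" and iso: "\<And>x y. norm (T x - T y) = norm (x - y)"
    and "integrable lborel2 (energy_density p q u)"
  shows "integrable lborel2 (energy_density p q (\<lambda>x. u (T x)))"
proof -
  have "energy_density p q (\<lambda>x. u (T x)) = (\<lambda>z. energy_density p q u (T (fst z), T (snd z)))"
    by (simp add: energy_density_def ker_def iso fun_eq_iff)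
  then show ?thesis using pair_lborel_map(1)[of T T "energy_density p q u"] assms by simp
qed

lemma energy_density_diff:
  fixes u v :: "'a::euclidean_space \<Rightarrow> real"
  assumes p: "0 < p" and [measurable]: "u \<in> borel_measurable borel" "v \<in> borel_measurable borel"
    and "integrable lborel2 (energy_density p q u)" "integrable lborel2 (energy_density p q v)"
  shows "integrable lborel2 (energy_density p q (\<lambda>x. u x - v x))"
proof (rule Bochner_Integration.integrable_bound)
  show "integrable lborel2 (\<lambda>z. 2 powr p * (energy_density p q u z + energy_density p q v z))"
    using assms by simp
  show "AE z in lborel2. norm (energy_density p q (\<lambda>x. u x - v x) z)
      \<le> norm (2 powr p * (energy_density p q u z + energy_density p q v z))"
  proof (intro AE_I2)
    fix z :: "'a \<times> 'a"
    have *: "\<bar>a - b\<bar> powr p \<le> 2 powr p * (\<bar>a\<bar> powr p + \<bar>b\<bar> powr p)" for a b :: real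
    proof -
      have "\<bar>a - b\<bar> powr p \<le> (2 * max \<bar>a\<bar> \<bar>b\<bar>) powr p"
        using p by (intro powr_mono2) auto
      also have "\<dots> = 2 powr p * (max \<bar>a\<bar> \<bar>b\<bar>) powr p" by (simp add: powr_mult)
      also have "\<dots> \<le> 2 powr p * (\<bar>a\<bar> powr p + \<bar>b\<bar> powr p)"
        by (intro mult_left_mono) (auto simp: max_def)
      finally show ?thesis .
    qed
    from mult_right_mono[OF this[of "u (fst z) - u (snd z)" "v (fst z) - v (snd z)"],
        OF ker_nonneg[of q "fst z" "snd z"]]
    show "norm (energy_density p q (\<lambda>x. u x - v x) z)
        \<le> norm (2 powr p * (energy_density p q u z + energy_density p q v z))"
      by (simp add: energy_density_def algebra_simps abs_mult)
  qed
qed measurable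

lemma nn_integral_lborel_affine:
  fixes F :: "'a::euclidean_space \<Rightarrow> ennreal"
  assumes [measurable]: "F \<in> borel_measurable borel" and c: "c > 0"
  shows "(\<integral>\<^sup>+x. F x \<partial>lborel) = ennreal (c ^ DIM('a)) * (\<integral>\<^sup>+x. F (t + c *\<^sub>R x) \<partial>lborel)"
proof -
  have "(\<integral>\<^sup>+x. F x \<partial>lborel)
      = (\<integral>\<^sup>+x. F x \<partial>(density (distr lborel borel (\<lambda>x. t + c *\<^sub>R x)) (\<lambda>_. ennreal (\<bar>c\<bar>^DIM('a)))))"
    using lborel_affine[of c t] c by simp
  also have "\<dots> = ennreal (c ^ DIM('a)) * (\<integral>\<^sup>+x. F (t + c *\<^sub>R x) \<partial>lborel)"
    using c by (simp add: nn_integral_density nn_integral_distr nn_integral_cmult)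
  finally show ?thesis .
qed

text \<open>
  Dilated copies of \<open>u\<close> supply test functions with arbitrarily small support without any estimate of
  singular integrals.
\<close>

lemma energy_density_dilation:
  fixes u :: "'a::euclidean_space \<Rightarrow> real"
  assumes [measurable]: "u \<in> borel_measurable borel" and c: "c > 0"
    and int: "integrable lborel2 (energy_density p q u)"
  shows "integrable lborel2 (energy_density p q (\<lambda>x. u (t + c *\<^sub>R x)))"
proof -
  let ?v = "\<lambda>x. u (t + c *\<^sub>R x)"
  let ?A = "\<lambda>x. t + c *\<^sub>R x :: 'a"
  let ?C = "ennreal (c ^ DIM('a))"
  have C: "?C \<noteq> 0" using c by simp
  have dens: "energy_density p q ?v (x, y) = c powr q * energy_density p q u (?A x, ?A y)" for x y
  proof -
    have "norm (?A x - ?A y) = c * norm (x - y)"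
      using c by (simp flip: scaleR_diff_right)
    then show ?thesis using c by (simp add: energy_density_def ker_def powr_mult)
  qed
  have "\<infinity> > (\<integral>\<^sup>+z. ennreal (energy_density p q u z) \<partial>lborel2)"
    using int by (simp add: integrable_energy_density_iff)
  also have "(\<integral>\<^sup>+z. ennreal (energy_density p q u z) \<partial>lborel2)
      = (\<integral>\<^sup>+x. \<integral>\<^sup>+y. ennreal (energy_density p q u (x, y)) \<partial>lborel \<partial>lborel)"
    by (rule lborel.nn_integral_fst[symmetric]) measurable
  also have "\<dots> = ?C * (\<integral>\<^sup>+x. \<integral>\<^sup>+y. ennreal (energy_density p q u (?A x, y)) \<partial>lborel \<partial>lborel)"
    by (rule nn_integral_lborel_affine[OF _ c]) measurable
  also have "\<dots> = ?C * (\<integral>\<^sup>+x. ?C * (\<integral>\<^sup>+y. ennreal (energy_density p q u (?A x, ?A y)) \<partial>lborel) \<partial>lborel)"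
    by (subst nn_integral_lborel_affine[OF _ c, of "\<lambda>y. ennreal (energy_density p q u (_, y))" t]) simp_all
  also have "\<dots> = ?C * (?C * (\<integral>\<^sup>+x. \<integral>\<^sup>+y. ennreal (energy_density p q u (?A x, ?A y)) \<partial>lborel \<partial>lborel))"
    by (subst nn_integral_cmult) auto
  finally have fin: "(\<integral>\<^sup>+x. \<integral>\<^sup>+y. ennreal (energy_density p q u (?A x, ?A y)) \<partial>lborel \<partial>lborel) < \<infinity>"
    using C by (auto simp: ennreal_mult_less_top less_top[symmetric] ennreal_mult_eq_top_iff)
  have "(\<integral>\<^sup>+z. ennreal (energy_density p q ?v z) \<partial>lborel2)
      = (\<integral>\<^sup>+x. \<integral>\<^sup>+y. ennreal (energy_density p q ?v (x, y)) \<partial>lborel \<partial>lborel)"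
    by (rule lborel.nn_integral_fst[symmetric]) measurable
  also have "\<dots> = (\<integral>\<^sup>+x. \<integral>\<^sup>+y. ennreal (c powr q) * ennreal (energy_density p q u (?A x, ?A y)) \<partial>lborel \<partial>lborel)"
    unfolding dens by (simp add: ennreal_mult)
  also have "\<dots> = ennreal (c powr q) * (\<integral>\<^sup>+x. \<integral>\<^sup>+y. ennreal (energy_density p q u (?A x, ?A y)) \<partial>lborel \<partial>lborel)"
    by (simp add: nn_integral_cmult)
  also have "\<dots> < \<infinity>" using fin by (simp add: ennreal_mult_less_top)
  finally show ?thesis by (simp add: integrable_energy_density_iff)
qed

section \<open>The antisymmetric test function\<close>

definition mirror_gap :: "'a::euclidean_space \<Rightarrow> real \<Rightarrow> ('a \<Rightarrow> real) \<Rightarrow> 'a \<Rightarrow> real" where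
  "mirror_gap e l u x = u x - u (mirror e l x)"

text \<open>
  The positive part of the gap on the cap, continued as an odd function across the hyperplane. Off the
  cap the odd continuation is the negative part of the gap with its sign, because the gap itself is odd.
\<close>

definition odd_test :: "'a::euclidean_space \<Rightarrow> real \<Rightarrow> ('a \<Rightarrow> real) \<Rightarrow> 'a \<Rightarrow> real" where
  "odd_test e l u x =
     (if l < x \<bullet> e then max (mirror_gap e l u x) 0 else min (mirror_gap e l u x) 0)"

lemma borel_measurable_mirror_gap [measurable]:
  assumes [measurable]: "u \<in> borel_measurable borel"
  shows "mirror_gap e l u \<in> borel_measurable borel"
  unfolding mirror_gap_def by measurable

lemma borel_measurable_odd_test [measurable]:
  assumes [measurable]: "u \<in> borel_measurable borel"
  shows "odd_test e l u \<in> borel_measurable borel"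
  unfolding odd_test_def by measurable

lemma mirror_fixed: "x \<bullet> e = l \<Longrightarrow> mirror e l x = x"
  by (simp add: mirror_def)

lemma mirror_gap_mirror: "norm e = 1 \<Longrightarrow> mirror_gap e l u (mirror e l x) = - mirror_gap e l u x"
  by (simp add: mirror_gap_def)

lemma odd_test_eq_max: "l \<le> x \<bullet> e \<Longrightarrow> odd_test e l u x = max (mirror_gap e l u x) 0"
  by (cases "x \<bullet> e = l") (auto simp: odd_test_def mirror_gap_def mirror_fixed)

lemma odd_test_mirror:
  assumes "norm e = 1"
  shows "odd_test e l u (mirror e l x) = - odd_test e l u x"
proof (cases "x \<bullet> e = l")
  case True
  then show ?thesis by (simp add: mirror_fixed odd_test_def mirror_gap_def)
next
  case False
  then show ?thesis using assms
    by (auto simp: odd_test_def mirror_gap_mirror inner_mirror max_def min_def)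
qed

lemma ker_mirror_mirror: "norm e = 1 \<Longrightarrow> ker q (mirror e l x) (mirror e l y) = ker q x y"
  by (simp add: ker_def norm_mirror_diff)

lemma ker_mirror_swap: "norm e = 1 \<Longrightarrow> ker q (mirror e l x) y = ker q x (mirror e l y)"
  by (simp add: ker_def norm_mirror_swap)

lemma ker_mirror_le:
  assumes "norm e = 1" "0 \<le> q" "l \<le> x \<bullet> e" "l \<le> y \<bullet> e" "x \<noteq> y"
  shows "ker q x (mirror e l y) \<le> ker q x y"
  unfolding ker_def using norm_diff_mirror_ge[OF assms(1,3,4)] assms
  by (intro divide_left_mono powr_mono2 mult_pos_pos) (auto simp: powr_def)

text \<open>
  On one side of the hyperplane truncation is a contraction. For points on different sides, either the
  gaps have opposite signs and truncation again contracts, or the increment of the test function is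
  bounded by that of the gap between \<open>x\<close> and the mirror image of \<open>y\<close>, which is closer to \<open>x\<close> than \<open>y\<close>.
\<close>

lemma odd_test_energy_le:
  fixes e x y :: "'a::euclidean_space" and u :: "'a \<Rightarrow> real" and l p q :: real
  assumes e: "norm e = 1" and p: "0 < p" and q: "0 \<le> q"
  defines "w \<equiv> mirror_gap e l u"
  shows "energy_density p q (odd_test e l u) (x, y)
    \<le> energy_density p q w (x, y) + energy_density p q w (x, mirror e l y)"
proof -
  let ?T = "mirror e l" and ?\<phi> = "odd_test e l u"
  have wT: "w (?T a) = - w a" for a unfolding w_def by (rule mirror_gap_mirror[OF e])
  have same: "energy_density p q ?\<phi> (x, y) \<le> energy_density p q w (x, y)"
    if "\<bar>?\<phi> x - ?\<phi> y\<bar> \<le> \<bar>w x - w y\<bar>"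
    using that p unfolding energy_density_def by (auto intro!: mult_right_mono powr_mono2)
  have cross: "energy_density p q ?\<phi> (x, y) \<le> energy_density p q w (x, ?T y)"
    if "\<bar>?\<phi> x - ?\<phi> y\<bar> \<le> \<bar>w x + w y\<bar>" "ker q x y \<le> ker q x (?T y)"
    using that p unfolding energy_density_def
    by (auto intro!: mult_mono powr_mono2 simp: wT)
  have zero: "energy_density p q ?\<phi> (x, y) \<le> energy_density p q w (x, ?T y)" if "?\<phi> x = ?\<phi> y"
    using that p unfolding energy_density_def by auto
  have K: "ker q x y \<le> ker q x (?T y)"
    if "l \<le> x \<bullet> e \<and> y \<bullet> e \<le> l \<or> x \<bullet> e \<le> l \<and> l \<le> y \<bullet> e" "x \<noteq> ?T y"
  proof (cases "l \<le> x \<bullet> e \<and> y \<bullet> e \<le> l")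
    case True
    then show ?thesis
      using ker_mirror_le[OF e q, of l x "?T y"] that e by (simp add: inner_mirror)
  next
    case False
    then have "l \<le> ?T x \<bullet> e" "l \<le> y \<bullet> e" "?T x \<noteq> y" using that e by (auto simp: inner_mirror)
    from ker_mirror_le[OF e q this] e show ?thesis
      by (simp add: ker_mirror_mirror ker_mirror_swap)
  qed
  consider "(l < x \<bullet> e) = (l < y \<bullet> e)" | "(l < x \<bullet> e) \<noteq> (l < y \<bullet> e)" by blast
  then have "energy_density p q ?\<phi> (x, y) \<le> energy_density p q w (x, y)
      \<or> energy_density p q ?\<phi> (x, y) \<le> energy_density p q w (x, ?T y)"
  proof cases
    case 1
    then have "\<bar>?\<phi> x - ?\<phi> y\<bar> \<le> \<bar>w x - w y\<bar>"
      unfolding odd_test_def w_def by auto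
    then show ?thesis using same by blast
  next
    case 2
    show ?thesis
    proof (cases "?\<phi> x = ?\<phi> y")
      case False
      consider "\<bar>?\<phi> x - ?\<phi> y\<bar> \<le> \<bar>w x - w y\<bar>" | "\<bar>?\<phi> x - ?\<phi> y\<bar> \<le> \<bar>w x + w y\<bar>" "w x + w y \<noteq> 0"
      proof -
        have *: "\<bar>max a 0 - min b 0\<bar> \<le> \<bar>a - b\<bar> \<or> \<bar>max a 0 - min b 0\<bar> \<le> \<bar>a + b\<bar> \<and> a + b \<noteq> 0"
          if "max a 0 \<noteq> min b 0" for a b :: real
          using that by (simp add: max_def min_def abs_if split: if_splits)
        show ?thesis
        proof (cases "l < x \<bullet> e")
          case True
          then have "?\<phi> x = max (w x) 0" "?\<phi> y = min (w y) 0" using 2 by (simp_all add: odd_test_def w_def)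
          then show ?thesis using *[of "w x" "w y"] False that by metis
        next
          case F: False
          then have "?\<phi> x = min (w x) 0" "?\<phi> y = max (w y) 0" using 2 by (simp_all add: odd_test_def w_def)
          then show ?thesis using *[of "w y" "w x"] False that by (metis abs_minus_commute add.commute)
        qed
      qed
      then show ?thesis
      proof cases
        case 2
        then have "x \<noteq> ?T y" using wT by auto
        moreover have "l \<le> x \<bullet> e \<and> y \<bullet> e \<le> l \<or> x \<bullet> e \<le> l \<and> l \<le> y \<bullet> e"
          using \<open>(l < x \<bullet> e) \<noteq> (l < y \<bullet> e)\<close> by auto
        ultimately show ?thesis using cross[OF 2(1) K] by blast
      qed (use same in blast)
    qed (use zero in blast)
  qed
  then show ?thesis
    using energy_density_nonneg[of p q w "(x, y)"] energy_density_nonneg[of p q w "(x, ?T y)"] by linarith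
qed

lemma integrable_odd_test_energy:
  fixes e :: "'a::euclidean_space"
  assumes e: "e \<in> Basis \<or> - e \<in> Basis" and p: "0 < p" and q: "0 \<le> q"
    and [measurable]: "u \<in> borel_measurable borel"
    and int: "integrable lborel2 (energy_density p q u)"
  shows "integrable lborel2 (energy_density p q (odd_test e l u))"
proof (rule Bochner_Integration.integrable_bound)
  have e1: "norm e = 1" using e norm_Basis by fastforce
  note d = distr_lborel_mirror[OF e, of l]
  let ?w = "mirror_gap e l u"
  have "integrable lborel2 (energy_density p q (\<lambda>x. u (mirror e l x)))"
    by (rule energy_density_isometry) (use d e1 int in \<open>auto simp: norm_mirror_diff\<close>)
  from energy_density_diff[OF p _ _ int this]
  have w: "integrable lborel2 (energy_density p q ?w)"
    by (simp add: mirror_gap_def [abs_def])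
  have "integrable lborel2 (\<lambda>z. energy_density p q ?w (fst z, mirror e l (snd z)))"
    using pair_lborel_map(1)[of "\<lambda>x. x" "mirror e l" "energy_density p q ?w"] d w
    by (simp add: distr_id2)
  with w show "integrable lborel2
      (\<lambda>z. energy_density p q ?w z + energy_density p q ?w (fst z, mirror e l (snd z)))" by simp
  show "AE z in lborel2. norm (energy_density p q (odd_test e l u) z)
      \<le> norm (energy_density p q ?w z + energy_density p q ?w (fst z, mirror e l (snd z)))"
    using odd_test_energy_le[OF e1 p q, of l u] by (intro AE_I2) (auto simp: split_paired_all)
qed measurable

text \<open>
  Here \<open>a, b\<close> are the values of \<open>u\<close> at \<open>x, y\<close>, and \<open>a', b'\<close> those at the mirror images; \<open>K1 \<ge> K2\<close> are
  the kernels at \<open>(x, y)\<close> and \<open>(x, T y)\<close>. Splitting \<open>K1 = (K1 - K2) + K2\<close> leaves two expressions. The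
  one with \<open>K1 - K2\<close> compares \<open>a - b\<close> with \<open>a' - b'\<close>, whose order agrees with that of \<open>f\<close> and \<open>g\<close>. The
  one with \<open>K2\<close> regroups to \<open>f * (A + B) + g * (B - A)\<close>. In \<open>A + B\<close> the same two numbers \<open>b, b'\<close>
  are subtracted from \<open>a\<close> and from \<open>a'\<close>, so its sign is that of \<open>a - a'\<close>; the sign of \<open>B - A\<close> is that
  of \<open>b - b'\<close> for the same reason.
\<close>

lemma spow_reflection_ineq:
  fixes a a' b b' :: real
  assumes p: "1 < p" "p < 2" and M: "0 < M"
    and bounds: "a \<in> {0..M}" "a' \<in> {0..M}" "b \<in> {0..M}" "b' \<in> {0..M}"
    and K: "0 \<le> K2" "K2 \<le> K1"
  defines "c \<equiv> (p - 1) * M powr (p - 2)"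
    and "A \<equiv> spow p (a - b) - spow p (a' - b')" and "B \<equiv> spow p (a - b') - spow p (a' - b)"
    and "f \<equiv> max (a - a') 0" and "g \<equiv> max (b - b') 0"
  shows "c * f * ((K1 - K2) * max (b' - b) 0 + 2 * K2 * f) \<le> A * (f - g) * K1 + B * (f + g) * K2"
proof -
  have c0: "0 < c" using p M by (simp add: c_def)
  have G: "c * (s - t) \<le> spow p s - spow p t" if "t \<le> s" "\<bar>s\<bar> \<le> M" "\<bar>t\<bar> \<le> M" for s t
    using spow_diff_ge[OF p that(2,3,1) M] by (simp add: c_def)
  have 1: "c * f * max (b' - b) 0 \<le> A * (f - g)"
  proof (cases "a' - b' \<le> a - b")
    case True
    have "c * ((a - b) - (a' - b')) \<le> A" unfolding A_def
      by (rule G) (use True bounds in auto)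
    moreover have "0 \<le> f - g" using True by (auto simp: f_def g_def)
    ultimately have "c * ((a - b) - (a' - b')) * (f - g) \<le> A * (f - g)" by (rule mult_right_mono)
    moreover have "f * max (b' - b) 0 \<le> ((a - b) - (a' - b')) * (f - g)"
    proof (cases "0 < f \<and> b < b'")
      case True
      then have "f = a - a'" "g = 0" by (auto simp: f_def g_def max_def split: if_splits)
      then have eqs: "(a - b) - (a' - b') = f + (b' - b)" "f - g = f" by simp_all
      have "((a - b) - (a' - b')) * (f - g) = f * f + f * (b' - b)"
        unfolding eqs by (simp only: distrib_left mult.commute)
      then show ?thesis using True by simp
    next
      case False
      then have z: "f * max (b' - b) 0 = 0" by (auto simp: f_def)
      show ?thesis unfolding z
        by (intro mult_nonneg_nonneg) (use \<open>0 \<le> f - g\<close> \<open>a' - b' \<le> a - b\<close> in auto)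
    qed
    then have "c * (f * max (b' - b) 0) \<le> c * (((a - b) - (a' - b')) * (f - g))"
      using c0 by (intro mult_left_mono) auto
    ultimately show ?thesis by (simp add: mult.assoc)
  next
    case False
    have "c * ((a' - b') - (a - b)) \<le> - A" unfolding A_def
      using G[of "a - b" "a' - b'"] False bounds by auto
    moreover have "0 \<le> c * ((a' - b') - (a - b))" using c0 False by simp
    ultimately have "A \<le> 0" by linarith
    moreover have "f - g \<le> 0" using False by (auto simp: f_def g_def)
    ultimately have "0 \<le> A * (f - g)" by (rule mult_nonpos_nonpos)
    moreover have "c * f * max (b' - b) 0 = 0" using False by (auto simp: f_def max_def)
    ultimately show ?thesis by linarith
  qed
  have 2: "2 * c * f * f \<le> f * (A + B)"
  proof (cases "a' \<le> a")
    case True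
    have "c * (a - a') \<le> spow p (a - b) - spow p (a' - b)"
      "c * (a - a') \<le> spow p (a - b') - spow p (a' - b')"
      using G[of "a' - b" "a - b"] G[of "a' - b'" "a - b'"] True bounds by auto
    then have "2 * c * f \<le> A + B" using True by (simp add: A_def B_def f_def)
    then have "f * (2 * c * f) \<le> f * (A + B)" by (rule mult_left_mono) (simp add: f_def)
    then show ?thesis by (simp add: mult_ac)
  qed (simp add: f_def)
  have 3: "0 \<le> g * (B - A)"
  proof (cases "b' \<le> b")
    case True
    have "spow p (a - b) \<le> spow p (a - b')" "spow p (a' - b) \<le> spow p (a' - b')"
      using spow_mono[OF p] True by auto
    then show ?thesis by (simp add: A_def B_def g_def)
  qed (simp add: g_def)
  have "c * f * ((K1 - K2) * max (b' - b) 0 + 2 * K2 * f)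
      = (K1 - K2) * (c * f * max (b' - b) 0) + K2 * (2 * c * f * f)" by (simp add: algebra_simps)
  also have "\<dots> \<le> (K1 - K2) * (A * (f - g)) + K2 * (f * (A + B) + g * (B - A))"
    by (intro add_mono mult_left_mono) (use 1 2 3 K in auto)
  also have "\<dots> = A * (f - g) * K1 + B * (f + g) * K2" by (simp add: algebra_simps)
  finally show ?thesis .
qed

text \<open>
  Up to the ellipticity constant, this is the lower bound for the folded integrand. The first summand
  is large where the gap is negative, the second one near the hyperplane.
\<close>

definition mirror_coercivity ::
    "real \<Rightarrow> 'a::euclidean_space \<Rightarrow> real \<Rightarrow> ('a \<Rightarrow> real) \<Rightarrow> 'a \<Rightarrow> 'a \<Rightarrow> real" where
  "mirror_coercivity q e l u x y = odd_test e l u x *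
     ((ker q x y - ker q x (mirror e l y)) * max (- mirror_gap e l u y) 0
      + 2 * ker q x (mirror e l y) * odd_test e l u x)"

lemma borel_measurable_mirror_coercivity [measurable]:
  assumes [measurable]: "u \<in> borel_measurable borel"
  shows "(\<lambda>z. mirror_coercivity q e l u (fst z) (snd z)) \<in> borel_measurable lborel2"
  unfolding mirror_coercivity_def by measurable

lemma mirror_coercivity_ge_diagonal:
  assumes e: "norm e = 1" and q: "0 \<le> q" and xy: "l \<le> x \<bullet> e" "l \<le> y \<bullet> e"
  shows "2 * ker q x (mirror e l y) * (odd_test e l u x)\<^sup>2 \<le> mirror_coercivity q e l u x y"
proof -
  have "0 \<le> odd_test e l u x * ((ker q x y - ker q x (mirror e l y)) * max (- mirror_gap e l u y) 0)"
  proof (cases "x = y")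
    case True
    then show ?thesis using xy by (auto simp: odd_test_eq_max max_def)
  next
    case False
    then show ?thesis using ker_mirror_le[OF e q xy] xy
      by (intro mult_nonneg_nonneg) (auto simp: odd_test_eq_max)
  qed
  then show ?thesis unfolding mirror_coercivity_def
    by (simp add: distrib_left power2_eq_square mult_ac)
qed

lemma mirror_coercivity_nonneg:
  assumes "norm e = 1" "0 \<le> q" "l \<le> x \<bullet> e" "l \<le> y \<bullet> e"
  shows "0 \<le> mirror_coercivity q e l u x y"
  using mirror_coercivity_ge_diagonal[OF assms] by (rule order_trans[rotated]) simp

text \<open>
  Reflecting both variables changes \<open>u\<close> into \<open>u \<circ> T\<close> and the sign of the test function; reflecting one
  of them exchanges \<open>K(x, y)\<close> and \<open>K(x, T y)\<close>. The sum \<open>J\<close> of the integrand over the four reflections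
  therefore has four times the integral of the form. It is invariant under all of them and nonnegative
  on pairs from the closed cap, hence nonnegative everywhere, and the integral can be restricted to the
  cap.
\<close>

lemma form_odd_test_ge:
  fixes e :: "'a::euclidean_space" and u :: "'a \<Rightarrow> real" and l :: real
  assumes e: "e \<in> Basis \<or> - e \<in> Basis" and p: "1 < p" "p < 2" and q: "0 \<le> q" and M: "0 < M"
    and [measurable]: "u \<in> borel_measurable borel" and u: "\<And>x. u x \<in> {0..M}"
    and int: "integrable lborel2 (energy_density p q u)"
  defines "S \<equiv> {x. l < x \<bullet> e}"
  shows "(\<integral>\<^sup>+z. ennreal ((p - 1) * M powr (p - 2) * mirror_coercivity q e l u (fst z) (snd z)) * indicator (S \<times> S) z \<partial>lborel2)
    \<le> ennreal (4 * (LINT z|lborel2. form_density p q u (odd_test e l u) z))"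
proof -
  let ?T = "mirror e l" and ?\<phi> = "odd_test e l u" and ?w = "mirror_gap e l u" and ?K = "ker q"
  define c where "c = (p - 1) * M powr (p - 2)"
  have c0: "0 < c" using p M by (simp add: c_def)
  have e1: "norm e = 1" using e norm_Basis by fastforce
  note d = distr_lborel_mirror[OF e, of l]
  define F where "F = form_density p q u ?\<phi>"
  define H where "H x y = F (x, y) + F (?T x, ?T y)" for x y
  define J where "J x y = H x y + H x (?T y)" for x y
  have [measurable]: "F \<in> borel_measurable lborel2" unfolding F_def by measurable
  have intF: "integrable lborel2 F" unfolding F_def
    by (intro integrable_form_density integrable_odd_test_energy) (use e p q int in auto)
  have d0: "distr lborel borel (\<lambda>x. x) = (lborel :: 'a measure)" by (simp add: distr_id2)
  have F1: "integrable lborel2 (\<lambda>z. F (?T (fst z), ?T (snd z)))"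
       "(LINT z|lborel2. F (?T (fst z), ?T (snd z))) = (LINT z|lborel2. F z)"
    by (rule pair_lborel_map(1)[OF _ _ d d _ intF] pair_lborel_map(2)[OF _ _ d d]; measurable)+
  have F2: "integrable lborel2 (\<lambda>z. F (fst z, ?T (snd z)))"
       "(LINT z|lborel2. F (fst z, ?T (snd z))) = (LINT z|lborel2. F z)"
    by (rule pair_lborel_map(1)[OF _ _ d0 d _ intF] pair_lborel_map(2)[OF _ _ d0 d]; measurable)+
  have F3: "integrable lborel2 (\<lambda>z. F (?T (fst z), snd z))"
       "(LINT z|lborel2. F (?T (fst z), snd z)) = (LINT z|lborel2. F z)"
    by (rule pair_lborel_map(1)[OF _ _ d d0 _ intF] pair_lborel_map(2)[OF _ _ d d0]; measurable)+
  have Jeq: "J x y = F (x, y) + F (?T x, ?T y) + F (x, ?T y) + F (?T x, y)" for x y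
    using e1 by (simp add: J_def H_def)
  have intJ: "integrable lborel2 (\<lambda>z. J (fst z) (snd z))"
    unfolding Jeq using intF F1 F2 F3 by simp
  have J4: "(LINT z|lborel2. J (fst z) (snd z)) = 4 * (LINT z|lborel2. F z)"
    unfolding Jeq using intF F1 F2 F3 by simp
  have JT: "J (?T x) y = J x y" "J x (?T y) = J x y" for x y
    unfolding Jeq using e1 by simp_all
  have bound: "c * mirror_coercivity q e l u x y \<le> J x y" if xy: "l \<le> x \<bullet> e" "l \<le> y \<bullet> e" for x y
  proof -
    let ?a = "u x" and ?a' = "u (?T x)" and ?b = "u y" and ?b' = "u (?T y)"
    have \<phi>: "?\<phi> x = max (?a - ?a') 0" "?\<phi> y = max (?b - ?b') 0"
      using xy by (simp_all add: odd_test_eq_max mirror_gap_def)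
    have odd: "?\<phi> (?T z) = - ?\<phi> z" for z by (rule odd_test_mirror[OF e1])
    let ?A = "spow p (?a - ?b) - spow p (?a' - ?b')"
    let ?B = "spow p (?a - ?b') - spow p (?a' - ?b)"
    have J: "J x y = ?A * (?\<phi> x - ?\<phi> y) * ?K x y + ?B * (?\<phi> x + ?\<phi> y) * ?K x (?T y)"
      using e1 unfolding Jeq F_def form_density_def
      by (simp add: odd ker_mirror_mirror ker_mirror_swap) (simp add: algebra_simps)
    have C: "c * mirror_coercivity q e l u x y
        = c * ?\<phi> x * ((?K x y - ?K x (?T y)) * max (?b' - ?b) 0 + 2 * ?K x (?T y) * ?\<phi> x)"
      by (simp add: mirror_coercivity_def mirror_gap_def)
    show ?thesis
    \<comment> \<open>on the diagonal the kernel vanishes, so \<open>K(x, T y)\<close> takes the place of the larger kernel there\<close>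
    proof (cases "x = y")
      case False
      show ?thesis unfolding C J unfolding \<phi> c_def
        by (rule spow_reflection_ineq[OF p M])
           (use u ker_mirror_le[OF e1 q xy False] in auto)
    next
      case True
      have ineq: "c * ?\<phi> x * ((?K x (?T y) - ?K x (?T y)) * max (?b' - ?b) 0 + 2 * ?K x (?T y) * ?\<phi> x)
        \<le> ?A * (?\<phi> x - ?\<phi> y) * ?K x (?T y) + ?B * (?\<phi> x + ?\<phi> y) * ?K x (?T y)"
        unfolding \<phi> c_def by (rule spow_reflection_ineq[OF p M]) (use u in auto)
      have drop: "c * ?\<phi> x * (k * max (?b' - ?b) 0 + r) = c * ?\<phi> x * r" for k r
        using True by (auto simp: \<phi> max_def)
      have A0: "?A = 0" using True by simp
      show ?thesis using ineq unfolding C J drop A0 by simp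
    qed
  qed
  \<comment> \<open>the reflections move any pair into the closed cap without changing \<open>J\<close>\<close>
  have J0: "0 \<le> J x y" for x y
  proof -
    define x' where "x' = (if l \<le> x \<bullet> e then x else ?T x)"
    define y' where "y' = (if l \<le> y \<bullet> e then y else ?T y)"
    have "l \<le> x' \<bullet> e" "l \<le> y' \<bullet> e" using e1 by (auto simp: x'_def y'_def inner_mirror)
    from bound[OF this] mirror_coercivity_nonneg[OF e1 q this, of u] c0
    have "0 \<le> J x' y'" by (meson mult_nonneg_nonneg less_imp_le order_trans)
    then show ?thesis by (auto simp: x'_def y'_def JT split: if_splits)
  qed
  have "(\<integral>\<^sup>+z. ennreal (c * mirror_coercivity q e l u (fst z) (snd z)) * indicator (S \<times> S) z \<partial>lborel2)
      \<le> (\<integral>\<^sup>+z. ennreal (J (fst z) (snd z)) \<partial>lborel2)"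
    by (intro nn_integral_mono) (auto simp: indicator_def S_def intro!: ennreal_leI bound)
  also have "\<dots> = ennreal (LINT z|lborel2. J (fst z) (snd z))"
    by (rule nn_integral_eq_integral[OF intJ]) (simp add: J0)
  finally show ?thesis unfolding J4 F_def c_def .
qed

text \<open>
  Since the test function is odd, the integral folds to one of \<open>(f (u x) - f (u (T x))) * \<phi> x\<close> over the
  cap, and there \<open>\<phi>\<close> is the gap wherever it is positive.
\<close>

lemma reaction_odd_test_le:
  fixes e :: "'a::euclidean_space" and u :: "'a \<Rightarrow> real" and l :: real
  assumes e: "e \<in> Basis \<or> - e \<in> Basis"
    and [measurable]: "u \<in> borel_measurable borel" "f \<in> borel_measurable borel"
    and u: "\<And>x. u x \<in> {0..M}" and supp: "\<And>x. R < norm x \<Longrightarrow> u x = 0"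
    and lip: "L-lipschitz_on {0..M} f"
  defines "S \<equiv> {x. l < x \<bullet> e}" and "\<phi> \<equiv> odd_test e l u"
  shows "(LINT x|lborel. f (u x) * \<phi> x) \<le> (LINT x|lborel. L * (\<phi> x)\<^sup>2 * indicator S x)"
    and "integrable lborel (\<lambda>x. L * (\<phi> x)\<^sup>2 * indicator S x)"
proof -
  let ?T = "mirror e l"
  have e1: "norm e = 1" using e norm_Basis by fastforce
  note d = distr_lborel_mirror[OF e, of l]
  have [measurable]: "\<phi> \<in> borel_measurable borel" unfolding \<phi>_def by measurable
  have [measurable]: "S \<in> sets borel" unfolding S_def by measurable
  define R' where "R' = R + norm (?T 0)"
  have far: "R < norm x" "R < norm (?T x)" if "R' < norm x" for x
  proof -
    show "R < norm x" using that norm_ge_zero[of "?T 0"] unfolding R'_def by linarith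
    have "norm x = norm (?T x - ?T 0)" using norm_mirror_diff[OF e1, of l x 0] by simp
    also have "\<dots> \<le> norm (?T x) + norm (?T 0)" by (rule norm_triangle_ineq4)
    finally show "R < norm (?T x)" using that by (simp add: R'_def)
  qed
  have \<phi>0: "\<phi> x = 0" if "R' < norm x" for x
    using far[OF that] by (simp add: \<phi>_def odd_test_def mirror_gap_def supp)
  have \<phi>M: "\<bar>\<phi> x\<bar> \<le> M" for x
    using u[of x] u[of "?T x"] by (auto simp: \<phi>_def odd_test_def mirror_gap_def)
  have L: "0 \<le> L" using lip by (rule lipschitz_on_nonneg)
  have lip': "\<bar>f a - f b\<bar> \<le> L * \<bar>a - b\<bar>" if "a \<in> {0..M}" "b \<in> {0..M}" for a b
    using lipschitz_onD[OF lip that] by (simp add: dist_real_def)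
  define C where "C = \<bar>f 0\<bar> + L * M"
  have M0: "0 \<le> M" using u[of 0] by simp
  have fC: "\<bar>f (u x)\<bar> \<le> C" for x
  proof -
    have "\<bar>f (u x) - f 0\<bar> \<le> L * \<bar>u x - 0\<bar>" using u[of x] M0 by (intro lip') auto
    also have "\<dots> \<le> L * M" using u[of x] L by (intro mult_left_mono) auto
    finally show ?thesis by (simp add: C_def)
  qed
  have prod_le: "\<bar>f (u x) * \<phi> y\<bar> \<le> C * M" for x y
    unfolding abs_mult using fC[of x] \<phi>M[of y] by (intro mult_mono) auto
  have i1: "integrable lborel (\<lambda>x. f (u x) * \<phi> x * indicator S x)"
    by (rule integrable_bounded_support[of _ "C * M" R'])
       (use prod_le \<phi>0 M0 in \<open>auto simp: indicator_def intro: order_trans[OF abs_ge_zero]\<close>)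
  have i2: "integrable lborel (\<lambda>x. f (u x) * \<phi> x * indicator (- S) x)"
    by (rule integrable_bounded_support[of _ "C * M" R'])
       (use prod_le \<phi>0 M0 in \<open>auto simp: indicator_def intro: order_trans[OF abs_ge_zero]\<close>)
  have i3: "integrable lborel (\<lambda>x. f (u (?T x)) * \<phi> x * indicator S x)"
    by (rule integrable_bounded_support[of _ "C * M" R'])
       (use prod_le \<phi>0 M0 in \<open>auto simp: indicator_def intro: order_trans[OF abs_ge_zero]\<close>)
  show i4: "integrable lborel (\<lambda>x. L * (\<phi> x)\<^sup>2 * indicator S x)"
  proof (rule integrable_bounded_support[of _ "L * M\<^sup>2" R'])
    fix x show "\<bar>L * (\<phi> x)\<^sup>2 * indicator S x\<bar> \<le> L * M\<^sup>2"
      using L \<phi>M[of x] M0 by (auto simp: indicator_def abs_mult intro!: mult_left_mono abs_le_square_iff[THEN iffD1])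
  qed (use \<phi>0 in auto)
  have "(LINT x|lborel. f (u x) * \<phi> x * indicator (- S) x)
      = (LINT x|lborel. f (u (?T x)) * \<phi> (?T x) * indicator (- S) (?T x))"
    by (rule integral_lborel_map[symmetric, OF _ d]) measurable
  also have "\<dots> = (LINT x|lborel. - (f (u (?T x)) * \<phi> x * indicator S x))"
  proof (intro Bochner_Integration.integral_cong refl)
    fix x
    have "\<phi> x = 0" if "x \<bullet> e = l"
      using that by (simp add: \<phi>_def odd_test_def mirror_gap_def mirror_fixed)
    then show "f (u (?T x)) * \<phi> (?T x) * indicator (- S) (?T x) = - (f (u (?T x)) * \<phi> x * indicator S x)"
      using e1 by (auto simp: \<phi>_def odd_test_mirror indicator_def S_def inner_mirror)
  qed
  finally have neg: "(LINT x|lborel. f (u x) * \<phi> x * indicator (- S) x)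
      = - (LINT x|lborel. f (u (?T x)) * \<phi> x * indicator S x)" by simp
  have "(LINT x|lborel. f (u x) * \<phi> x)
      = (LINT x|lborel. f (u x) * \<phi> x * indicator S x + f (u x) * \<phi> x * indicator (- S) x)"
    by (intro Bochner_Integration.integral_cong) (auto simp: indicator_def)
  also have "\<dots> = (LINT x|lborel. f (u x) * \<phi> x * indicator S x - f (u (?T x)) * \<phi> x * indicator S x)"
    using i1 i2 i3 neg by simp
  also have "\<dots> \<le> (LINT x|lborel. L * (\<phi> x)\<^sup>2 * indicator S x)"
  proof (rule integral_mono)
    fix x
    show "f (u x) * \<phi> x * indicator S x - f (u (?T x)) * \<phi> x * indicator S x \<le> L * (\<phi> x)\<^sup>2 * indicator S x"
    proof (cases "x \<in> S \<and> 0 < \<phi> x")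
      case True
      then have "\<phi> x = u x - u (?T x)"
        by (auto simp: \<phi>_def S_def odd_test_def mirror_gap_def max_def split: if_splits)
      then have "f (u x) - f (u (?T x)) \<le> L * \<phi> x"
        using lip'[OF u[of x] u[of "?T x"]] True by auto
      then have "(f (u x) - f (u (?T x))) * \<phi> x \<le> L * \<phi> x * \<phi> x"
        using True by (intro mult_right_mono) auto
      then show ?thesis using True by (simp add: power2_eq_square algebra_simps)
    next
      case False
      then have "x \<notin> S \<or> \<phi> x = 0"
        by (auto simp: \<phi>_def S_def odd_test_def max_def split: if_splits)
      then show ?thesis by auto
    qed
  qed (use i1 i3 i4 in auto)
  finally show "(LINT x|lborel. f (u x) * \<phi> x) \<le> (LINT x|lborel. L * (\<phi> x)\<^sup>2 * indicator S x)" .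
qed

lemma mirror_coercivity_ge_offdiagonal:
  assumes "l \<le> x \<bullet> e"
  shows "odd_test e l u x * ((ker q x y - ker q x (mirror e l y)) * max (- mirror_gap e l u y) 0)
     \<le> mirror_coercivity q e l u x y"
  using assms unfolding mirror_coercivity_def
  by (intro mult_left_mono) (auto simp: odd_test_eq_max)

text \<open>
  A lower bound for \<open>K(x, y) - K(x, T y)\<close> that is uniform for bounded \<open>x, y\<close> away from the hyperplane.
  With \<open>h\<close> the squared distance of \<open>x\<close> and \<open>y\<close>, it is the value at the largest \<open>h\<close>, as both factors of
  \<open>h powr (- q / 2) * (1 - (h / (h + m)) powr (q / 2))\<close> decrease in \<open>h\<close>.
\<close>

lemma ker_gap_lower:
  fixes x y e :: "'a::euclidean_space"
  assumes e: "norm e = 1" and q: "0 < q" and m: "0 < m" and ne: "x \<noteq> y"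
    and D: "norm (x - y) \<le> D"
    and gap: "m \<le> 4 * (x \<bullet> e - l) * (y \<bullet> e - l)"
  shows "(D\<^sup>2) powr (- q / 2) * (1 - (D\<^sup>2 / (D\<^sup>2 + m)) powr (q / 2))
      \<le> ker q x y - ker q x (mirror e l y)"
proof -
  define h where "h = (norm (x - y))\<^sup>2"
  define k where "k = (norm (x - mirror e l y))\<^sup>2"
  have h: "0 < h" using ne by (simp add: h_def)
  have hD: "h \<le> D\<^sup>2" unfolding h_def using D by (intro power_mono) auto
  have k: "h + m \<le> k" unfolding h_def k_def norm_diff_mirror_sq[OF e] using gap by simp
  have sq: "ker q a b = ((norm (a - b))\<^sup>2) powr (- q / 2)" if "a \<noteq> b" for a b :: 'a
  proof -
    have "((norm (a - b))\<^sup>2) powr (- q / 2) = norm (a - b) powr (- q)"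
      using powr_powr[of "norm (a - b)" 2 "- q / 2"] that by simp
    then show ?thesis by (simp add: ker_def powr_minus_divide)
  qed
  have K1: "ker q x y = h powr (- q / 2)" unfolding h_def by (rule sq[OF ne])
  have "x \<noteq> mirror e l y" using k h m by (auto simp: k_def)
  then have K2: "ker q x (mirror e l y) = k powr (- q / 2)" unfolding k_def by (rule sq)
  have "k powr (- q / 2) \<le> (h + m) powr (- q / 2)"
    using k h m q by (intro powr_mono2') auto
  moreover have "h powr (- q / 2) - (h + m) powr (- q / 2) = h powr (- q / 2) * (1 - (h / (h + m)) powr (q / 2))"
    using h m by (simp add: powr_divide powr_minus_divide right_diff_distrib field_simps)
  moreover have "(D\<^sup>2) powr (- q / 2) * (1 - (D\<^sup>2 / (D\<^sup>2 + m)) powr (q / 2))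
      \<le> h powr (- q / 2) * (1 - (h / (h + m)) powr (q / 2))"
  proof (rule mult_mono)
    show "(D\<^sup>2) powr (- q / 2) \<le> h powr (- q / 2)" using h hD q by (intro powr_mono2') auto
    have "h / (h + m) \<le> D\<^sup>2 / (D\<^sup>2 + m)" using h hD m by (simp add: field_simps)
    then show "1 - (D\<^sup>2 / (D\<^sup>2 + m)) powr (q / 2) \<le> 1 - (h / (h + m)) powr (q / 2)"
      using h m q by (simp add: powr_mono2)
    have "D\<^sup>2 / (D\<^sup>2 + m) \<le> 1" using m by (simp add: add_nonneg_pos divide_le_eq_1_pos)
    then show "0 \<le> 1 - (D\<^sup>2 / (D\<^sup>2 + m)) powr (q / 2)"
      using q m by (simp add: powr_le1)
  qed simp
  ultimately show ?thesis unfolding K1 K2 by linarith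
qed

section \<open>Solutions and their reflections\<close>

text \<open>
  The data of the problem, with bounds \<open>M\<close> for \<open>u\<close> and \<open>R\<close> for its support, and a Lipschitz constant of
  \<open>f\<close> on the range of \<open>u\<close>. Convexity and symmetry of \<open>\<Omega>\<close> in direction \<open>e\<close> are combined in
  \<open>fold\<close>: caps at nonnegative levels are reflected into the domain.
\<close>

locale moving_plane =
  fixes s p M R L :: real and \<Omega> :: "(real ^ 'n::finite) set" and f :: "real \<Rightarrow> real"
    and u :: "real ^ 'n \<Rightarrow> real" and e :: "real ^ 'n"
  assumes s: "0 < s" and p: "1 < p" "p < 2" and M: "0 < M" and L: "0 < L"
    and e: "e \<in> Basis \<or> - e \<in> Basis"
    and open_dom: "open \<Omega>"
    and fold: "\<And>x l. x \<in> \<Omega> \<Longrightarrow> 0 \<le> l \<Longrightarrow> l \<le> x \<bullet> e \<Longrightarrow> mirror e l x \<in> \<Omega>"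
    and f_borel [measurable]: "f \<in> borel_measurable borel" and lip: "L-lipschitz_on {0..M} f"
    and cont: "continuous_on UNIV u" and range: "\<And>x. u x \<in> {0..M}"
    and supp: "\<And>x. R < norm x \<Longrightarrow> u x = 0"
    and sol: "weak_solution s p \<Omega> f u"
begin

definition q :: real where "q = real CARD('n) + s * p"

text \<open>
  The ellipticity constant of \<open>spow_diff_ge\<close>.
\<close>

definition c :: real where "c = (p - 1) * M powr (p - 2)"

abbreviation gap :: "real \<Rightarrow> real ^ 'n \<Rightarrow> real" where "gap l \<equiv> mirror_gap e l u"

abbreviation test :: "real \<Rightarrow> real ^ 'n \<Rightarrow> real" where "test l \<equiv> odd_test e l u"

abbreviation cap :: "real \<Rightarrow> (real ^ 'n) set" where "cap l \<equiv> {x. l < x \<bullet> e}"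

lemma e1: "norm e = 1"
  using e norm_Basis by fastforce

lemma q_pos: "0 < q"
  unfolding q_def using s p by (intro add_nonneg_pos) auto

lemma c_pos: "0 < c"
  using p M by (simp add: c_def)

lemma u_borel [measurable]: "u \<in> borel_measurable borel"
  by (rule borel_measurable_continuous_onI[OF cont])

lemma u_energy: "integrable lborel2 (energy_density p q u)"
  and u_outside: "AE x in lborel. x \<notin> \<Omega> \<longrightarrow> u x = 0"
  using sol unfolding weak_solution_def q_def by (simp_all add: Wsp0_iff)

lemma continuous_on_gap: "continuous_on A (gap l)"
  unfolding mirror_gap_def
  by (intro continuous_intros continuous_on_subset[OF cont] continuous_on_compose2[OF cont]) auto

lemma open_cap: "open (cap l)"
  by (intro open_Collect_less continuous_intros)

lemma weak_test:
  assumes [measurable]: "\<phi> \<in> borel_measurable borel" and \<phi>: "\<phi> \<in> Wsp0 s p \<Omega>"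
  shows "(LINT z|lborel2. form_density p q u \<phi> z) = (LINT x|lborel. f (u x) * \<phi> x)"
proof -
  have "integrable lborel2 (form_density p q u \<phi>)"
    using \<phi> p u_energy by (intro integrable_form_density) (auto simp: Wsp0_iff q_def)
  then have "frac_p_form s p u \<phi> = (LINT z|lborel2. form_density p q u \<phi> z)"
    using frac_p_form_eq[of u \<phi> p s] unfolding q_def by simp
  moreover have "pairing \<Omega> (\<lambda>x. f (u x)) \<phi> = (LINT x|lborel. f (u x) * \<phi> x)"
    by (rule pairing_eq) (use \<phi> open_dom in \<open>auto simp: Wsp0_iff borel_open\<close>)
  ultimately show ?thesis using sol \<phi> by (simp add: weak_solution_def)
qed

text \<open>
  On the cap but off the domain, \<open>u = 0\<close> makes the gap nonpositive. Below the hyperplane a point off the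
  domain has its mirror image off the domain too, by \<open>fold\<close>.
\<close>

lemma test_in_Wsp0:
  assumes l: "0 \<le> l"
  shows "test l \<in> Wsp0 s p \<Omega>"
proof -
  let ?T = "mirror e l"
  have supp_test: "test l x = 0" if "R + norm (?T 0) < norm x" for x
  proof -
    have "norm x \<le> norm (?T x) + norm (?T 0)"
      using norm_mirror_diff[OF e1, of l x 0] norm_triangle_ineq4[of "?T x" "?T 0"] by simp
    then have "R < norm (?T x)" "R < norm x" using that norm_ge_zero[of "?T 0"] by linarith+
    then show ?thesis by (simp add: odd_test_def mirror_gap_def supp)
  qed
  have le: "\<bar>test l x\<bar> \<le> M" for x
    using range[of x] range[of "?T x"] by (auto simp: odd_test_def mirror_gap_def)
  have "integrable lborel (\<lambda>x. \<bar>test l x\<bar> powr p)"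
    by (rule integrable_bounded_support[of _ "M powr p" "R + norm (?T 0)"])
       (use le supp_test p in \<open>auto intro!: powr_mono2\<close>)
  moreover have "integrable lborel2 (energy_density p q (test l))"
    by (rule integrable_odd_test_energy) (use e p q_pos u_energy in auto)
  moreover have "AE x in lborel. x \<notin> \<Omega> \<longrightarrow> test l x = 0"
    using u_outside AE_lborel_map[OF borel_measurable_mirror distr_lborel_mirror[OF e] u_outside, of l]
  proof eventually_elim
    case (elim x)
    show ?case
    proof
      assume x: "x \<notin> \<Omega>"
      show "test l x = 0"
      proof (cases "l < x \<bullet> e")
        case True
        then show ?thesis using elim x range[of "?T x"] by (simp add: odd_test_def mirror_gap_def)
      next
        case False
        have "?T x \<notin> \<Omega>"
          using fold[of "?T x" l] x l False e1 by (auto simp: inner_mirror)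
        then show ?thesis using elim False range[of x] by (simp add: odd_test_def mirror_gap_def)
      qed
    qed
  qed
  ultimately show ?thesis by (simp add: Wsp0_iff q_def)
qed

text \<open>
  Integrating the hypothesis over the cap and inserting the equation gives
  \<open>(4 L + 1) \<integral> \<phi>\<^sup>2 \<le> 4 L \<integral> \<phi>\<^sup>2\<close>, where the factor 4 comes from the four reflections.
\<close>

lemma gap_nonpos_if_coercive:
  assumes l: "0 \<le> l"
    and coercive: "\<And>x. l < x \<bullet> e \<Longrightarrow> 0 < test l x \<Longrightarrow> ennreal ((4 * L + 1) * (test l x)\<^sup>2)
      \<le> (\<integral>\<^sup>+y. ennreal (c * mirror_coercivity q e l u x y) * indicator (cap l) y \<partial>lborel)"
  shows "l < x \<bullet> e \<Longrightarrow> gap l x \<le> 0"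
proof -
  let ?D = "\<lambda>z. ennreal (c * mirror_coercivity q e l u (fst z) (snd z)) * indicator (cap l \<times> cap l) z"
  let ?I = "LINT x|lborel. (test l x)\<^sup>2 * indicator (cap l) x"
  have [measurable]: "cap l \<in> sets borel" by (rule borel_open[OF open_cap])
  have D_borel: "?D \<in> borel_measurable lborel2" by measurable
  have "integrable lborel (\<lambda>x. L * (test l x)\<^sup>2 * indicator (cap l) x)"
    by (rule reaction_odd_test_le(2)[OF e u_borel f_borel range supp lip])
  from integrable_mult_right[OF this, of "inverse L"]
  have int: "integrable lborel (\<lambda>x. (test l x)\<^sup>2 * indicator (cap l) x)"
    using L by (simp add: mult.assoc[symmetric])
  have "(\<integral>\<^sup>+x. ennreal ((4 * L + 1) * ((test l x)\<^sup>2 * indicator (cap l) x)) \<partial>lborel)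
      \<le> (\<integral>\<^sup>+x. \<integral>\<^sup>+y. ?D (x, y) \<partial>lborel \<partial>lborel)"
  proof (intro nn_integral_mono)
    fix x
    show "ennreal ((4 * L + 1) * ((test l x)\<^sup>2 * indicator (cap l) x)) \<le> (\<integral>\<^sup>+y. ?D (x, y) \<partial>lborel)"
    proof (cases "l < x \<bullet> e \<and> 0 < test l x")
      case True
      then have "(\<integral>\<^sup>+y. ?D (x, y) \<partial>lborel)
         = (\<integral>\<^sup>+y. ennreal (c * mirror_coercivity q e l u x y) * indicator (cap l) y \<partial>lborel)"
        by (intro nn_integral_cong) (auto simp: indicator_def)
      then show ?thesis using coercive[of x] True by simp
    next
      case False
      then have zero: "(test l x)\<^sup>2 * indicator (cap l) x = 0"
        by (auto simp: odd_test_def indicator_def max_def)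
      show ?thesis unfolding zero by simp
    qed
  qed
  also have "\<dots> = (\<integral>\<^sup>+z. ?D z \<partial>lborel2)"
    by (rule lborel.nn_integral_fst[OF D_borel])
  also have "\<dots> \<le> ennreal (4 * (LINT z|lborel2. form_density p q u (test l) z))"
    unfolding c_def using form_odd_test_ge[OF e p less_imp_le[OF q_pos] M u_borel range u_energy, of l] .
  also have "(LINT z|lborel2. form_density p q u (test l) z) = (LINT x|lborel. f (u x) * test l x)"
    by (rule weak_test[OF _ test_in_Wsp0[OF l]]) measurable
  also have "ennreal (4 * (LINT x|lborel. f (u x) * test l x)) \<le> ennreal (4 * (L * ?I))"
    using reaction_odd_test_le(1)[where l = l, OF e u_borel f_borel range supp lip]
    by (intro ennreal_leI) (simp add: mult.assoc)
  finally have le: "(\<integral>\<^sup>+x. ennreal ((4 * L + 1) * ((test l x)\<^sup>2 * indicator (cap l) x)) \<partial>lborel)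
      \<le> ennreal (4 * (L * ?I))" .
  have "(\<integral>\<^sup>+x. ennreal ((4 * L + 1) * ((test l x)\<^sup>2 * indicator (cap l) x)) \<partial>lborel)
      = ennreal ((4 * L + 1) * ?I)"
    using int L by (subst nn_integral_eq_integral) auto
  with le have "ennreal ((4 * L + 1) * ?I) \<le> ennreal (4 * (L * ?I))" by simp
  moreover have I0: "0 \<le> ?I" by (intro Bochner_Integration.integral_nonneg) auto
  ultimately have "(4 * L + 1) * ?I \<le> 4 * (L * ?I)"
    using L by (subst (asm) ennreal_le_iff) auto
  then have "?I \<le> 0" by (simp add: algebra_simps)
  with I0 have "?I = 0" by (rule antisym[rotated])
  then have "AE x in lborel. (test l x)\<^sup>2 * indicator (cap l) x = 0"
    using int by (subst (asm) integral_nonneg_eq_0_iff_AE) auto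
  then have "AE x in lborel. x \<notin> {x \<in> cap l. 0 < gap l x}"
    by eventually_elim (auto simp: odd_test_def)
  moreover have "open {x \<in> cap l. 0 < gap l x}"
  proof -
    have "open {x. 0 < gap l x}"
      by (intro open_Collect_less continuous_on_gap continuous_on_const)
    then show ?thesis using open_Int[OF open_cap, of "{x. 0 < gap l x}" l] by (simp add: Int_def)
  qed
  ultimately have "{x \<in> cap l. 0 < gap l x} = {}" by (intro AE_open_imp_empty)
  then have "x \<notin> {x \<in> cap l. 0 < gap l x}" by blast
  then show "l < x \<bullet> e \<Longrightarrow> gap l x \<le> 0" by simp
qed

text \<open>
  The ball around \<open>x\<close> that touches the hyperplane lies in the cap, and the mirror images of its points
  have distance at most three radii from \<open>x\<close>. Integrating the kernel over it yields a multiple of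
  \<open>d powr (- s p)\<close>, with \<open>d\<close> the distance of \<open>x\<close> from the hyperplane.
\<close>

lemma coercive_near_hyperplane:
  obtains \<eta> where "0 < \<eta>" and "\<And>l x. l < x \<bullet> e \<Longrightarrow> x \<bullet> e < l + \<eta> \<Longrightarrow>
    ennreal ((4 * L + 1) * (test l x)\<^sup>2)
      \<le> (\<integral>\<^sup>+y. ennreal (c * mirror_coercivity q e l u x y) * indicator (cap l) y \<partial>lborel)"
proof -
  define \<beta> where "\<beta> = unit_ball_vol (real CARD('n))"
  have \<beta>: "0 < \<beta>" by (simp add: \<beta>_def)
  define A where "A = (4 * L + 1) / (2 * c * \<beta> * 3 powr (- q))"
  have A: "0 < A" using L c_pos \<beta> by (simp add: A_def)
  have sp: "0 < s * p" using s p by simp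
  \<comment> \<open>the distance \<open>d\<close> at which \<open>d powr (- s p)\<close> equals the required constant \<open>A\<close>\<close>
  define \<eta> where "\<eta> = A powr (- 1 / (s * p))"
  have \<eta>: "0 < \<eta>" using A by (simp add: \<eta>_def)
  show ?thesis
  proof (rule that[OF \<eta>])
    fix l x assume x: "l < x \<bullet> e" "x \<bullet> e < l + \<eta>"
    define d where "d = x \<bullet> e - l"
    have d: "0 < d" "d < \<eta>" using x by (auto simp: d_def)
    have "A = \<eta> powr (- (s * p))" using A s p by (simp add: \<eta>_def powr_powr)
    also have "\<dots> \<le> d powr (- (s * p))" using d sp by (intro powr_mono2') auto
    finally have Ad: "A \<le> d powr (- (s * p))" .
    let ?t = "test l x"
    let ?m = "c * (2 * (3 * d) powr (- q) * ?t\<^sup>2)"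
    have ball: "y \<bullet> e > l" "norm (x - mirror e l y) \<le> 3 * d" if "y \<in> ball x d" for y
    proof -
      have xy: "norm (x - y) < d" using that by (simp add: dist_norm)
      have "\<bar>(x - y) \<bullet> e\<bar> \<le> norm (x - y)" using Cauchy_Schwarz_ineq2[of "x - y" e] e1 by simp
      then show "y \<bullet> e > l" using xy by (simp add: d_def inner_diff_left)
      have "norm (x - mirror e l x) = 2 * d"
        using d e1 by (simp add: mirror_def d_def)
      moreover have "norm (mirror e l x - mirror e l y) < d" using xy norm_mirror_diff[OF e1] by simp
      ultimately show "norm (x - mirror e l y) \<le> 3 * d"
        using norm_triangle_ineq[of "x - mirror e l x" "mirror e l x - mirror e l y"] by simp
    qed
    have pt: "ennreal ?m \<le> ennreal (c * mirror_coercivity q e l u x y) * indicator (cap l) y"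
      if y: "y \<in> ball x d" for y
    proof -
      have "x \<noteq> mirror e l y"
      proof
        assume "x = mirror e l y"
        then have "x \<bullet> e = 2 * l - y \<bullet> e" using inner_mirror[OF e1] by simp
        then show False using ball(1)[OF y] x by simp
      qed
      then have "(3 * d) powr (- q) \<le> norm (x - mirror e l y) powr (- q)"
        using ball(2)[OF y] q_pos by (intro powr_mono2') auto
      then have "(3 * d) powr (- q) \<le> ker q x (mirror e l y)" by (simp add: ker_def powr_minus_divide)
      then have "2 * (3 * d) powr (- q) * ?t\<^sup>2 \<le> 2 * ker q x (mirror e l y) * ?t\<^sup>2"
        by (intro mult_right_mono) auto
      also have "\<dots> \<le> mirror_coercivity q e l u x y"
        using ball(1)[OF y] x q_pos by (intro mirror_coercivity_ge_diagonal) (auto simp: e1)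
      finally have "?m \<le> c * mirror_coercivity q e l u x y"
        using c_pos by (intro mult_left_mono) auto
      then show ?thesis using ball(1)[OF y] by (simp add: ennreal_leI)
    qed
    have "(4 * L + 1) * ?t\<^sup>2 \<le> ?m * (\<beta> * d ^ CARD('n))"
    proof -
      have "4 * L + 1 = A * (2 * c * \<beta> * 3 powr (- q))" using c_pos \<beta> by (simp add: A_def)
      also have "\<dots> \<le> d powr (- (s * p)) * (2 * c * \<beta> * 3 powr (- q))"
        using Ad c_pos \<beta> by (intro mult_right_mono) auto
      also have "d powr (- (s * p)) = d powr (- q) * d ^ CARD('n)"
        using d by (simp add: powr_realpow[symmetric] powr_add[symmetric] q_def)
      finally have "4 * L + 1 \<le> c * (2 * (3 * d) powr (- q)) * (\<beta> * d ^ CARD('n))"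
        using d by (simp add: powr_mult mult_ac)
      from mult_right_mono[OF this, of "?t\<^sup>2"] show ?thesis by (simp add: mult_ac)
    qed
    then have "ennreal ((4 * L + 1) * ?t\<^sup>2) \<le> ennreal ?m * ennreal (\<beta> * d ^ CARD('n))"
      using c_pos d \<beta> by (subst ennreal_mult[symmetric]) (auto intro!: ennreal_leI)
    also have "ennreal (\<beta> * d ^ CARD('n)) = emeasure lborel (ball x d)"
      using d by (simp add: emeasure_ball \<beta>_def)
    also have "ennreal ?m * emeasure lborel (ball x d)
      \<le> (\<integral>\<^sup>+y. ennreal (c * mirror_coercivity q e l u x y) * indicator (cap l) y \<partial>lborel)"
      by (rule nn_integral_ge_on_set[OF _ pt]) auto
    finally show "ennreal ((4 * L + 1) * ?t\<^sup>2)
      \<le> (\<integral>\<^sup>+y. ennreal (c * mirror_coercivity q e l u x y) * indicator (cap l) y \<partial>lborel)" .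
  qed
qed

text \<open>
  Here the negative gap on a fixed ball does the work. Its contribution is linear in the test function
  and so dominates the quadratic right-hand side where the test function is small.
\<close>

lemma coercive_away_from_hyperplane:
  assumes \<eta>: "0 < \<eta>" and \<rho>: "0 < \<rho>" and \<delta>: "0 < \<delta>"
  obtains \<kappa> where "0 < \<kappa>" and "\<And>l x. l + \<eta> \<le> x \<bullet> e \<Longrightarrow> 0 < test l x \<Longrightarrow> test l x \<le> \<kappa> \<Longrightarrow>
    (\<And>y. y \<in> ball y0 \<rho> \<Longrightarrow> l + \<rho> \<le> y \<bullet> e \<and> gap l y \<le> - \<delta>) \<Longrightarrow>
    ennreal ((4 * L + 1) * (test l x)\<^sup>2)
      \<le> (\<integral>\<^sup>+y. ennreal (c * mirror_coercivity q e l u x y) * indicator (cap l) y \<partial>lborel)"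
proof -
  define \<beta> where "\<beta> = unit_ball_vol (real CARD('n)) * \<rho> ^ CARD('n)"
  have \<beta>: "0 < \<beta>" using \<rho> by (simp add: \<beta>_def)
  define D where "D = \<bar>R\<bar> + norm y0 + \<rho>"
  have D: "0 < D" using \<rho> by (simp add: D_def add_nonneg_pos)
  define m where "m = 4 * \<eta> * \<rho>"
  have m: "0 < m" using \<eta> \<rho> by (simp add: m_def)
  define k where "k = (D\<^sup>2) powr (- q / 2) * (1 - (D\<^sup>2 / (D\<^sup>2 + m)) powr (q / 2))"
  have k: "0 < k"
  proof -
    have "(D\<^sup>2 / (D\<^sup>2 + m)) powr (q / 2) < 1 powr (q / 2)"
      using D m q_pos by (intro powr_less_mono2) (simp_all add: add_pos_pos)
    then show ?thesis using D by (simp add: k_def)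
  qed
  define \<kappa> where "\<kappa> = c * k * \<delta> * \<beta> / (4 * L + 1)"
  have \<kappa>: "0 < \<kappa>" using c_pos k \<delta> \<beta> L by (simp add: \<kappa>_def)
  show ?thesis
  proof (rule that[OF \<kappa>])
    fix l x
    assume x: "l + \<eta> \<le> x \<bullet> e" "0 < test l x" "test l x \<le> \<kappa>"
      and B: "\<And>y. y \<in> ball y0 \<rho> \<Longrightarrow> l + \<rho> \<le> y \<bullet> e \<and> gap l y \<le> - \<delta>"
    let ?t = "test l x"
    let ?m = "c * (?t * (k * \<delta>))"
    have "u x \<noteq> 0"
      using x(1,2) \<eta> range[of "mirror e l x"] by (auto simp: odd_test_def mirror_gap_def split: if_splits)
    then have xR: "norm x \<le> R" using supp[of x] by (meson not_less)
    have pt: "ennreal ?m \<le> ennreal (c * mirror_coercivity q e l u x y) * indicator (cap l) y"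
      if y: "y \<in> ball y0 \<rho> - {x}" for y
    proof -
      have By: "l + \<rho> \<le> y \<bullet> e" "gap l y \<le> - \<delta>" using B y by auto
      have "norm (x - y) \<le> norm x + norm y0 + norm (y0 - y)"
        using norm_triangle_ineq4[of x y] norm_triangle_sub[of y y0] by (simp add: norm_minus_commute)
      moreover have "norm (y0 - y) < \<rho>" using y by (simp add: dist_norm)
      ultimately have "norm (x - y) \<le> D" using xR abs_ge_self[of R] unfolding D_def by linarith
      moreover have "m \<le> 4 * (x \<bullet> e - l) * (y \<bullet> e - l)"
        unfolding m_def using x(1) By(1) \<eta> \<rho> by (intro mult_mono) auto
      ultimately have "k \<le> ker q x y - ker q x (mirror e l y)"
        unfolding k_def using y by (intro ker_gap_lower[OF e1 q_pos m]) auto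
      then have "k * \<delta> \<le> (ker q x y - ker q x (mirror e l y)) * max (- gap l y) 0"
        using By(2) k \<delta> by (intro mult_mono) auto
      then have "?t * (k * \<delta>) \<le> ?t * ((ker q x y - ker q x (mirror e l y)) * max (- gap l y) 0)"
        using x(2) by (intro mult_left_mono) auto
      also have "\<dots> \<le> mirror_coercivity q e l u x y"
        using x(1) \<eta> by (intro mirror_coercivity_ge_offdiagonal) auto
      finally have "?m \<le> c * mirror_coercivity q e l u x y"
        using c_pos by (intro mult_left_mono) auto
      then show ?thesis using By(1) \<rho> by (simp add: ennreal_leI)
    qed
    have "(4 * L + 1) * ?t\<^sup>2 \<le> ?m * \<beta>"
    proof -
      have "(4 * L + 1) * ?t \<le> (4 * L + 1) * \<kappa>" using x(3) L by (intro mult_left_mono) auto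
      also have "\<dots> = c * k * \<delta> * \<beta>" using L by (simp add: \<kappa>_def)
      finally have "(4 * L + 1) * ?t * ?t \<le> c * k * \<delta> * \<beta> * ?t" using x(2) by (intro mult_right_mono) auto
      then show ?thesis by (simp add: power2_eq_square mult_ac)
    qed
    then have "ennreal ((4 * L + 1) * ?t\<^sup>2) \<le> ennreal ?m * ennreal \<beta>"
      using c_pos \<beta> k \<delta> x(2) by (subst ennreal_mult[symmetric]) (auto intro!: ennreal_leI)
    also have "ennreal \<beta> = emeasure lborel (ball y0 \<rho>)"
      using \<rho> by (simp add: emeasure_ball \<beta>_def)
    also have "\<dots> = emeasure lborel (ball y0 \<rho> - {x})"
      by (rule emeasure_Diff_null_set[symmetric]) auto
    also have "ennreal ?m * \<dots>
      \<le> (\<integral>\<^sup>+y. ennreal (c * mirror_coercivity q e l u x y) * indicator (cap l) y \<partial>lborel)"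
      by (rule nn_integral_ge_on_set[OF _ pt]) auto
    finally show "ennreal ((4 * L + 1) * ?t\<^sup>2)
      \<le> (\<integral>\<^sup>+y. ennreal (c * mirror_coercivity q e l u x y) * indicator (cap l) y \<partial>lborel)" .
  qed
qed

section \<open>The plane moves past positive levels\<close>

lemma uniform_modulus:
  assumes "0 < \<epsilon>"
  obtains \<delta> where "0 < \<delta>"
    and "\<And>x y. norm x \<le> B \<Longrightarrow> norm y \<le> B \<Longrightarrow> norm (x - y) < \<delta> \<Longrightarrow> \<bar>u x - u y\<bar> < \<epsilon>"
proof -
  have "uniformly_continuous_on (cball 0 B) u"
    by (rule compact_uniformly_continuous[OF continuous_on_subset[OF cont]]) auto
  then obtain \<delta> where "0 < \<delta>" "\<forall>x\<in>cball 0 B. \<forall>y\<in>cball 0 B. dist y x < \<delta> \<longrightarrow> dist (u y) (u x) < \<epsilon>"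
    unfolding uniformly_continuous_on_def using assms by blast
  then show ?thesis by (intro that[of \<delta>]) (auto simp: dist_norm)
qed

lemma norm_mirror_le:
  "norm (mirror e l x) \<le> norm x + 2 * \<bar>l\<bar>"
proof -
  have "norm (mirror e l 0) = 2 * \<bar>l\<bar>" using e1 by (simp add: mirror_def)
  then show ?thesis
    using norm_triangle_sub[of "mirror e l x" "mirror e l 0"] norm_mirror_diff[OF e1, of l x 0] by simp
qed

text \<open>
  At a level slightly below \<open>l\<close>, points near the hyperplane are covered by the previous lemmas without
  further conditions. The remaining points of the cap already belong to the cap at level \<open>l\<close>, where the
  gap was nonpositive; by uniform continuity it is now at most \<open>\<kappa>\<close> there, and still at most \<open>- \<delta>\<close> on
  a ball around \<open>y0\<close>.
\<close>

lemma plane_moves_past: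
  assumes l: "0 < l" and nonpos: "\<And>x. l < x \<bullet> e \<Longrightarrow> gap l x \<le> 0"
    and y0: "l < y0 \<bullet> e" "gap l y0 < 0"
  obtains \<epsilon> where "0 < \<epsilon>" and "\<And>\<mu> x. 0 \<le> \<mu> \<Longrightarrow> l - \<epsilon> \<le> \<mu> \<Longrightarrow> \<mu> \<le> l \<Longrightarrow> \<mu> < x \<bullet> e \<Longrightarrow> gap \<mu> x \<le> 0"
proof -
  define \<delta> where "\<delta> = - gap l y0 / 3"
  have \<delta>: "0 < \<delta>" using y0 by (simp add: \<delta>_def)
  have "open {y. gap l y < - 2 * \<delta>}"
    by (intro open_Collect_less continuous_on_gap continuous_on_const)
  then have "open ({y. gap l y < - 2 * \<delta>} \<inter> cap l)" using open_cap by (rule open_Int)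
  moreover have "y0 \<in> {y. gap l y < - 2 * \<delta>} \<inter> cap l" using y0 by (simp add: \<delta>_def)
  ultimately obtain r where r: "0 < r" "ball y0 r \<subseteq> {y. gap l y < - 2 * \<delta>} \<inter> cap l"
    by (meson openE)
  \<comment> \<open>half the distance of \<open>y0\<close> to the hyperplane, so that the ball keeps the distance \<open>\<rho>\<close> from it\<close>
  define \<rho> where "\<rho> = min (r / 2) (min ((y0 \<bullet> e - l) / 2) 1)"
  have \<rho>: "0 < \<rho>" "\<rho> \<le> 1" using r y0 by (auto simp: \<rho>_def)
  have ball: "gap l y < - 2 * \<delta>" "l + \<rho> \<le> y \<bullet> e" if "y \<in> ball y0 \<rho>" for y
  proof -
    have "y \<in> ball y0 r" using that r by (auto simp: \<rho>_def)
    then show "gap l y < - 2 * \<delta>" using r by auto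
    have "\<bar>(y0 - y) \<bullet> e\<bar> \<le> norm (y0 - y)" using Cauchy_Schwarz_ineq2[of "y0 - y" e] e1 by simp
    moreover have "norm (y0 - y) < \<rho>" using that by (simp add: dist_norm)
    moreover have "\<rho> \<le> (y0 \<bullet> e - l) / 2"
      unfolding \<rho>_def by (intro min.coboundedI2 min.coboundedI1) simp
    ultimately show "l + \<rho> \<le> y \<bullet> e" by (simp add: inner_diff_left)
  qed
  obtain \<eta> where \<eta>: "0 < \<eta>" and near: "\<And>l x. l < x \<bullet> e \<Longrightarrow> x \<bullet> e < l + \<eta> \<Longrightarrow>
    ennreal ((4 * L + 1) * (test l x)\<^sup>2)
      \<le> (\<integral>\<^sup>+y. ennreal (c * mirror_coercivity q e l u x y) * indicator (cap l) y \<partial>lborel)"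
    using coercive_near_hyperplane by blast
  obtain \<kappa> where \<kappa>: "0 < \<kappa>" and far: "\<And>l x. l + \<eta> \<le> x \<bullet> e \<Longrightarrow> 0 < test l x \<Longrightarrow> test l x \<le> \<kappa> \<Longrightarrow>
    (\<And>y. y \<in> ball y0 \<rho> \<Longrightarrow> l + \<rho> \<le> y \<bullet> e \<and> gap l y \<le> - \<delta>) \<Longrightarrow>
    ennreal ((4 * L + 1) * (test l x)\<^sup>2)
      \<le> (\<integral>\<^sup>+y. ennreal (c * mirror_coercivity q e l u x y) * indicator (cap l) y \<partial>lborel)"
    using coercive_away_from_hyperplane[OF \<eta> \<rho>(1) \<delta>, of y0] by blast
  \<comment> \<open>contains the support of \<open>u\<close>, the ball around \<open>y0\<close> and their mirror images at levels in \<open>[0, l]\<close>\<close>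
  define B where "B = \<bar>R\<bar> + norm y0 + 1 + 2 * l"
  obtain \<gamma> where \<gamma>: "0 < \<gamma>"
    and mod: "\<And>x y. norm x \<le> B \<Longrightarrow> norm y \<le> B \<Longrightarrow> norm (x - y) < \<gamma> \<Longrightarrow> \<bar>u x - u y\<bar> < min \<kappa> \<delta>"
    using uniform_modulus[of "min \<kappa> \<delta>" B] \<kappa> \<delta> by auto
  define \<epsilon> where "\<epsilon> = min (\<eta> / 2) (\<gamma> / 4)"
  have \<epsilon>: "0 < \<epsilon>" "\<epsilon> < \<eta>" "2 * \<epsilon> < \<gamma>" using \<eta> \<gamma> by (auto simp: \<epsilon>_def min_def)
  have shift: "\<bar>gap \<mu> x - gap l x\<bar> < min \<kappa> \<delta>"
    if \<mu>: "0 \<le> \<mu>" "l - \<epsilon> \<le> \<mu>" "\<mu> \<le> l" and x: "norm x \<le> \<bar>R\<bar> + norm y0 + 1" for \<mu> x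
  proof -
    have "mirror e l x - mirror e \<mu> x = (2 * (l - \<mu>)) *\<^sub>R e"
      by (simp add: mirror_def algebra_simps)
    then have "norm (mirror e l x - mirror e \<mu> x) = 2 * (l - \<mu>)"
      using \<mu> e1 by simp
    then have "norm (mirror e l x - mirror e \<mu> x) < \<gamma>" using \<epsilon> \<mu> by simp
    moreover have "norm (mirror e l x) \<le> B" "norm (mirror e \<mu> x) \<le> B"
      using norm_mirror_le[of l x] norm_mirror_le[of \<mu> x] x \<mu> l by (auto simp: B_def)
    ultimately have "\<bar>u (mirror e l x) - u (mirror e \<mu> x)\<bar> < min \<kappa> \<delta>" by (intro mod)
    then show ?thesis by (simp add: mirror_gap_def)
  qed
  show ?thesis
  proof (rule that[OF \<epsilon>(1)])
    fix \<mu> x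
    assume \<mu>: "0 \<le> \<mu>" "l - \<epsilon> \<le> \<mu>" "\<mu> \<le> l" and "\<mu> < x \<bullet> e"
    from \<open>\<mu> < x \<bullet> e\<close> show "gap \<mu> x \<le> 0"
    proof (rule gap_nonpos_if_coercive[OF \<mu>(1), rotated])
      fix z assume z: "\<mu> < z \<bullet> e" "0 < test \<mu> z"
      show "ennreal ((4 * L + 1) * (test \<mu> z)\<^sup>2)
        \<le> (\<integral>\<^sup>+y. ennreal (c * mirror_coercivity q e \<mu> u z y) * indicator (cap \<mu>) y \<partial>lborel)"
      proof (cases "z \<bullet> e < \<mu> + \<eta>")
        case True
        then show ?thesis using near z by blast
      next
        case False
        have gz: "test \<mu> z = gap \<mu> z" using z by (auto simp: odd_test_def max_def split: if_splits)
        have "u z \<noteq> 0" using z(2) range[of "mirror e \<mu> z"] unfolding gz by (auto simp: mirror_gap_def)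
        then have "norm z \<le> R" using supp[of z] by (meson not_less)
        then have zR: "norm z \<le> \<bar>R\<bar> + norm y0 + 1" using norm_ge_zero[of y0] by linarith
        have "gap l z \<le> 0" using False \<mu> \<epsilon> by (intro nonpos) auto
        then have small: "test \<mu> z \<le> \<kappa>" using shift[OF \<mu> zR] unfolding gz by (simp add: abs_less_iff)
        show ?thesis
        proof (rule far)
          fix y assume y: "y \<in> ball y0 \<rho>"
          have "norm y \<le> norm y0 + norm (y0 - y)" using norm_triangle_sub[of y y0] by (simp add: norm_minus_commute)
          then have "norm y \<le> \<bar>R\<bar> + norm y0 + 1" using y \<rho> by (simp add: dist_norm)
          from shift[OF \<mu> this] ball[OF y] \<mu>
          show "\<mu> + \<rho> \<le> y \<bullet> e \<and> gap \<mu> y \<le> - \<delta>" by (simp add: abs_less_iff)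
        qed (use False z small in auto)
      qed
    qed
  qed
qed

section \<open>No symmetry about a positive level\<close>

lemma form_disjoint_support:
  assumes "u x * \<phi> x = 0" "u y * \<phi> y = 0"
  shows "form_density p q u \<phi> (x, y)
    = - (spow p (u y) * \<phi> x * ker q x y) - spow p (u x) * \<phi> y * ker q x y"
proof -
  consider "\<phi> x = 0" "\<phi> y = 0" | "u x = 0" "\<phi> y = 0" | "\<phi> x = 0" "u y = 0" | "u x = 0" "u y = 0"
    using assms by auto
  then show ?thesis
    by cases (simp_all add: form_density_def)
qed

text \<open>
  Where the test function lives, \<open>u\<close> vanishes; the form reduces to minus twice the potential of
  \<open>u powr (p - 1)\<close> integrated against the test function, and the reaction term to the constant \<open>f 0\<close>.
\<close>

lemma weak_test_zero_set:
  assumes [measurable]: "\<phi> \<in> borel_measurable borel" and \<phi>: "\<phi> \<in> Wsp0 s p \<Omega>"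
    and nonneg: "\<And>x. 0 \<le> \<phi> x" and disj: "\<And>x. u x * \<phi> x = 0"
  shows "integrable lborel2 (\<lambda>z. spow p (u (snd z)) * \<phi> (fst z) * ker q (fst z) (snd z))"
    and "- 2 * (LINT z|lborel2. spow p (u (snd z)) * \<phi> (fst z) * ker q (fst z) (snd z))
      = f 0 * (LINT x|lborel. \<phi> x)"
proof -
  let ?g = "\<lambda>z. spow p (u (snd z)) * \<phi> (fst z) * ker q (fst z) (snd z)"
  have spow0: "0 \<le> spow p (u x)" for x using range[of x] by (simp add: spow_def)
  have form: "form_density p q u \<phi> z = - ?g z - ?g (snd z, fst z)" for z
    using form_disjoint_support[of "fst z" \<phi> "snd z", OF disj disj]
    by (simp add: ker_commute[of q "snd z"])
  have intF: "integrable lborel2 (form_density p q u \<phi>)"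
    using \<phi> p u_energy by (intro integrable_form_density) (auto simp: Wsp0_iff q_def)
  show int: "integrable lborel2 ?g"
  proof (rule Bochner_Integration.integrable_bound[OF intF])
    show "AE z in lborel2. norm (?g z) \<le> norm (form_density p q u \<phi> z)"
    proof (intro AE_I2)
      fix z :: "(real ^ 'n) \<times> (real ^ 'n)"
      have "0 \<le> ?g z" "0 \<le> ?g (snd z, fst z)" using spow0 nonneg by simp_all
      then show "norm (?g z) \<le> norm (form_density p q u \<phi> z)" unfolding form real_norm_def by linarith
    qed
  qed measurable
  have "?g \<in> borel_measurable lborel2" by measurable
  from pair_lborel_swap[OF this] int
  have "(LINT z|lborel2. form_density p q u \<phi> z) = - 2 * (LINT z|lborel2. ?g z)"
    unfolding form by simp
  moreover have "(LINT z|lborel2. form_density p q u \<phi> z) = (LINT x|lborel. f (u x) * \<phi> x)"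
    using \<phi> by (intro weak_test) auto
  moreover have "f (u x) * \<phi> x = f 0 * \<phi> x" for x
    using disj[of x] by auto
  ultimately show "- 2 * (LINT z|lborel2. ?g z) = f 0 * (LINT x|lborel. \<phi> x)" by simp
qed

lemma dilate_in_Wsp0:
  assumes m: "0 < m" and inside: "\<And>x. u (t + m *\<^sub>R x) \<noteq> 0 \<Longrightarrow> x \<in> \<Omega>"
  shows "(\<lambda>x. u (t + m *\<^sub>R x)) \<in> Wsp0 s p \<Omega>"
proof -
  have supp': "u (t + m *\<^sub>R x) = 0" if x: "(R + norm t) / m < norm x" for x
  proof (rule supp)
    have "R + norm t < norm (m *\<^sub>R x)" using x m by (simp add: field_simps)
    also have "norm (m *\<^sub>R x) \<le> norm (t + m *\<^sub>R x) + norm t"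
      using norm_triangle_ineq4[of "t + m *\<^sub>R x" t] by simp
    finally show "R < norm (t + m *\<^sub>R x)" by simp
  qed
  have "integrable lborel (\<lambda>x. \<bar>u (t + m *\<^sub>R x)\<bar> powr p)"
    by (rule integrable_bounded_support[of _ "M powr p" "(R + norm t) / m"])
       (use range supp' p in \<open>auto intro!: powr_mono2\<close>)
  moreover have "integrable lborel2 (energy_density p q (\<lambda>x. u (t + m *\<^sub>R x)))"
    by (rule energy_density_dilation[OF u_borel m u_energy])
  ultimately show ?thesis using inside by (subst Wsp0_iff) (auto simp: q_def)
qed

text \<open>
  If \<open>u\<close> is nonzero and symmetric about the level \<open>l > 0\<close>, with \<open>b\<close> the supremum of the levels of
  \<open>{u > 0}\<close>, then \<open>{u > 0}\<close> lies at levels between \<open>2 l - b\<close> and \<open>b\<close>. The domain is symmetric about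
  level zero, hence contains points at levels near \<open>- b < 2 l - b\<close>. Near such a point \<open>z\<close> two test
  functions are compared: a dilated copy \<open>\<phi>\<close> of \<open>u\<close> and its translate \<open>\<psi>\<close> by \<open>- r e\<close>. Their integrals
  agree, so the integrals of the potential against them agree as well; but the
  translation moves every point of the support of \<open>\<phi>\<close> away from every point of \<open>{u > 0}\<close>.
\<close>

lemma not_symmetric_about_positive:
  assumes l: "0 < l" and sym: "\<And>x. l < x \<bullet> e \<Longrightarrow> gap l x = 0"
  shows "u x = 0"
proof (rule ccontr)
  assume "u x \<noteq> 0"
  have uT: "u (mirror e l x) = u x" for x
  proof -
    consider "l < x \<bullet> e" | "l < mirror e l x \<bullet> e" | "x \<bullet> e = l" using inner_mirror[OF e1, of l x] by linarith
    then show ?thesis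
    proof cases
      case 1 then show ?thesis using sym[of x] by (simp add: mirror_gap_def)
    next
      case 2 then show ?thesis using sym[of "mirror e l x"] e1 by (simp add: mirror_gap_def)
    qed (simp add: mirror_fixed)
  qed
  have open_pos: "open {x. 0 < u x}"
    by (intro open_Collect_less continuous_on_const cont)
  \<comment> \<open>\<open>u\<close> vanishes off \<open>\<Omega>\<close> only almost everywhere, so a positive value only shows that \<open>\<Omega>\<close> meets every neighbourhood\<close>
  have hit: "\<exists>x\<in>\<Omega>. x \<in> S" if "open S" "0 < u x" "x \<in> S" for S x
  proof (rule ccontr)
    assume "\<not> ?thesis"
    then have "AE x in lborel. x \<notin> {x. 0 < u x} \<inter> S"
      using u_outside by (auto elim!: eventually_mono)
    then have "{x. 0 < u x} \<inter> S = {}" using that(1) open_pos by (intro AE_open_imp_empty open_Int)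
    then show False using that by auto
  qed
  have "0 < u x" using \<open>u x \<noteq> 0\<close> range[of x] by simp
  then obtain x1 where x1: "0 < u x1" by blast
  obtain x0 where x0: "0 < u x0" "l \<le> x0 \<bullet> e"
  proof (cases "l \<le> x1 \<bullet> e")
    case True then show ?thesis using that x1 by blast
  next
    case False then show ?thesis using that[of "mirror e l x1"] x1 uT e1 by (simp add: inner_mirror)
  qed
  let ?P = "(\<lambda>x. x \<bullet> e) ` {x. 0 < u x}"
  define b where "b = Sup ?P"
  have bdd: "bdd_above ?P"
  proof (rule bdd_aboveI)
    fix t assume "t \<in> ?P"
    then obtain y where y: "t = y \<bullet> e" "u y \<noteq> 0" by auto
    then have "norm y \<le> R" using supp[of y] by (meson not_less)
    then show "t \<le> R" using y Cauchy_Schwarz_ineq2[of y e] e1 by simp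
  qed
  have le_b: "y \<bullet> e \<le> b" if "0 < u y" for y
    unfolding b_def by (rule cSup_upper[OF _ bdd]) (use that in auto)
  have ge_b: "2 * l - b \<le> y \<bullet> e" if "0 < u y" for y
    using le_b[of "mirror e l y"] that e1 by (simp add: uT inner_mirror)
  have "max (b - 2 * l) 0 < b" using x0 le_b[of x0] l by auto
  then obtain t where "t \<in> ?P" "max (b - 2 * l) 0 < t"
    using less_cSup_iff[OF _ bdd] x1 unfolding b_def by (metis (mono_tags, lifting) empty_iff image_eqI mem_Collect_eq)
  then obtain y where y: "0 < u y" "max (b - 2 * l) 0 < y \<bullet> e" by auto
  have "open {x. max (b - 2 * l) 0 < x \<bullet> e}" by (intro open_Collect_less continuous_intros)
  from hit[OF this y(1)] y(2) obtain x2 where x2: "x2 \<in> \<Omega>" "max (b - 2 * l) 0 < x2 \<bullet> e" by auto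
  define z where "z = mirror e 0 x2"
  have "z \<in> \<Omega>" unfolding z_def using fold[of x2 0] x2 by simp
  moreover have "z \<bullet> e < 2 * l - b" using x2 e1 by (simp add: z_def inner_mirror)
  moreover have "open {x. x \<bullet> e < 2 * l - b}" by (intro open_Collect_less continuous_intros)
  ultimately obtain r0 where r0: "0 < r0" "ball z r0 \<subseteq> \<Omega> \<inter> {x. x \<bullet> e < 2 * l - b}"
    using open_dom by (metis (mono_tags, lifting) IntI mem_Collect_eq open_Int openE)
  define r where "r = r0 / 2"
  have r: "0 < r" using r0 by (simp add: r_def)
  \<comment> \<open>dilation by \<open>m\<close> shrinks the support of \<open>u\<close> into a ball of radius less than \<open>r\<close>\<close>
  define m where "m = (\<bar>R\<bar> + 1) / r"
  have m: "0 < m" using r by (simp add: m_def)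
  define \<phi> where "\<phi> x = u (- m *\<^sub>R z + m *\<^sub>R x)" for x
  define \<psi> where "\<psi> x = u (- m *\<^sub>R (z - r *\<^sub>R e) + m *\<^sub>R x)" for x
  have \<psi>_eq: "\<psi> x = \<phi> (r *\<^sub>R e + x)" for x
    by (simp add: \<phi>_def \<psi>_def algebra_simps)
  have [measurable]: "\<phi> \<in> borel_measurable borel" "\<psi> \<in> borel_measurable borel"
    unfolding \<phi>_def \<psi>_def by measurable
  have \<phi>_supp: "norm (x - z) < r" if "\<phi> x \<noteq> 0" for x
  proof (rule ccontr)
    assume "\<not> norm (x - z) < r"
    then have "m * r \<le> m * norm (x - z)" using m by (intro mult_left_mono) auto
    then have "\<bar>R\<bar> + 1 \<le> m * norm (x - z)" using r by (simp add: m_def)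
    also have "\<dots> = norm (- m *\<^sub>R z + m *\<^sub>R x)"
      using m by (simp add: norm_minus_commute flip: scaleR_diff_right)
    finally have "\<phi> x = 0" unfolding \<phi>_def by (intro supp) linarith
    then show False using that by simp
  qed
  have \<psi>_supp: "norm (x - z) < 2 * r" if "\<psi> x \<noteq> 0" for x
  proof -
    have "norm (r *\<^sub>R e + x - z) < r" using \<phi>_supp that by (simp add: \<psi>_eq)
    moreover have "norm (x - z) \<le> norm (r *\<^sub>R e + x - z) + norm (r *\<^sub>R e)"
      using norm_triangle_ineq4[of "r *\<^sub>R e + x - z" "r *\<^sub>R e"] by (simp add: algebra_simps)
    ultimately show ?thesis using r e1 by simp
  qed
  have small: "x \<in> \<Omega>" "x \<bullet> e < 2 * l - b" "u x = 0" if "norm (x - z) < 2 * r" for x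
  proof -
    have "x \<in> ball z r0" using that by (simp add: r_def dist_norm norm_minus_commute)
    then show "x \<in> \<Omega>" "x \<bullet> e < 2 * l - b" using r0 by auto
    then show "u x = 0" using ge_b[of x] range[of x] by force
  qed
  have \<phi>_small: "norm (x - z) < 2 * r" if "\<phi> x \<noteq> 0" for x using \<phi>_supp[OF that] r by simp
  have W: "\<phi> \<in> Wsp0 s p \<Omega>" "\<psi> \<in> Wsp0 s p \<Omega>"
    unfolding \<phi>_def [abs_def] \<psi>_def [abs_def]
    by (rule dilate_in_Wsp0[OF m]; use small(1) \<phi>_small \<psi>_supp in \<open>simp add: \<phi>_def \<psi>_def\<close>)+
  have nonneg: "0 \<le> \<phi> x" "0 \<le> \<psi> x" for x using range by (simp_all add: \<phi>_def \<psi>_def)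
  have disj: "u x * \<phi> x = 0" "u x * \<psi> x = 0" for x
    using small(3) \<phi>_small \<psi>_supp by (metis mult_eq_0_iff)+
  let ?g = "\<lambda>z. spow p (u (snd z)) * \<phi> (fst z) * ker q (fst z) (snd z)"
  let ?h = "\<lambda>z. spow p (u (snd z)) * \<psi> (fst z) * ker q (fst z) (snd z)"
  let ?k = "\<lambda>z. spow p (u (snd z)) * \<phi> (fst z) * ker q (fst z - r *\<^sub>R e) (snd z)"
  have g: "integrable lborel2 ?g" "- 2 * (LINT z|lborel2. ?g z) = f 0 * (LINT x|lborel. \<phi> x)"
    by (rule weak_test_zero_set; use W nonneg disj in simp)+
  have h: "integrable lborel2 ?h" "- 2 * (LINT z|lborel2. ?h z) = f 0 * (LINT x|lborel. \<psi> x)"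
    by (rule weak_test_zero_set; use W nonneg disj in simp)+
  have shift: "distr lborel borel (\<lambda>x. - (r *\<^sub>R e) + x) = lborel" "distr lborel borel (\<lambda>x. r *\<^sub>R e + x) = lborel"
    by (rule lborel_distr_plus)+
  have d0: "distr lborel borel (\<lambda>x. x) = (lborel :: (real ^ 'n) measure)" by (simp add: distr_id2)
  define h' where "h' = ?h"
  have [measurable]: "h' \<in> borel_measurable lborel2" unfolding h'_def by measurable
  have k_eq: "?k = (\<lambda>z. h' (- (r *\<^sub>R e) + fst z, snd z))"
    by (simp add: h'_def \<psi>_eq algebra_simps)
  have k: "integrable lborel2 ?k" "(LINT z|lborel2. ?k z) = (LINT z|lborel2. h' z)"
    unfolding k_eq
    by (rule pair_lborel_map(1)[OF _ _ shift(1) d0 _ h(1)[folded h'_def]]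
        pair_lborel_map(2)[OF _ _ shift(1) d0]; measurable)+
  have "(LINT x|lborel. \<psi> x) = (LINT x|lborel. \<phi> x)"
    unfolding \<psi>_eq by (rule integral_lborel_map[OF _ shift(2)]) measurable
  then have "f 0 * (LINT x|lborel. \<psi> x) = f 0 * (LINT x|lborel. \<phi> x)" by simp
  with g(2) h(2) k(2)[unfolded h'_def] have "(LINT z|lborel2. ?g z) = (LINT z|lborel2. ?k z)" by linarith
  then have zero: "(LINT z|lborel2. ?g z - ?k z) = 0" using g(1) k(1) by simp
  have spow_pos: "0 < spow p (u y)" if "0 < u y" for y using that by (simp add: spow_def)
  have ker_less: "ker q (x - r *\<^sub>R e) y < ker q x y" if x: "\<phi> x \<noteq> 0" and y: "0 < u y" for x y
  proof -
    have xy: "x \<bullet> e < y \<bullet> e" using small(2)[OF \<phi>_small[OF x]] ge_b[OF y] by simp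
    have "(norm (x - r *\<^sub>R e - y))\<^sup>2 = (norm (x - y))\<^sup>2 + 2 * r * (y \<bullet> e - x \<bullet> e) + r\<^sup>2"
    proof -
      have "e \<bullet> e = 1" using e1 by (simp add: dot_square_norm)
      then show ?thesis unfolding power2_norm_eq_inner
        by (simp add: inner_diff_left inner_diff_right inner_commute algebra_simps power2_eq_square)
    qed
    moreover have "0 < 2 * r * (y \<bullet> e - x \<bullet> e) + r\<^sup>2" using r xy by (simp add: add_pos_pos)
    ultimately have "(norm (x - y))\<^sup>2 < (norm (x - r *\<^sub>R e - y))\<^sup>2" by linarith
    then have lt: "norm (x - y) < norm (x - r *\<^sub>R e - y)" by (rule power2_less_imp_less) simp
    have pos: "0 < norm (x - y) powr q" using xy by auto
    have "norm (x - y) powr q < norm (x - r *\<^sub>R e - y) powr q"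
      using lt q_pos by (intro powr_less_mono2) auto
    then show ?thesis unfolding ker_def
      using pos by (intro divide_strict_left_mono mult_pos_pos) linarith+
  qed
  have diff0: "0 \<le> ?g z - ?k z" for z
  proof (cases "\<phi> (fst z) \<noteq> 0 \<and> 0 < u (snd z)")
    case True
    then have "?k z \<le> ?g z"
      by (intro mult_left_mono mult_nonneg_nonneg less_imp_le[OF ker_less] nonneg
          less_imp_le[OF spow_pos]) auto
    then show ?thesis by simp
  next
    case False
    then have "\<phi> (fst z) = 0 \<or> u (snd z) = 0" using range[of "snd z"] by force
    then show ?thesis by auto
  qed
  have "AE z in lborel2. ?g z - ?k z = 0"
    using zero g(1) k(1) diff0 by (subst (asm) integral_nonneg_eq_0_iff_AE) auto
  then have "AE z in lborel. ?g z - ?k z = 0" unfolding lborel_prod .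
  then have "AE z in lborel. z \<notin> {x. 0 < \<phi> x} \<times> {x. 0 < u x}"
  proof eventually_elim
    case (elim w)
    show ?case
    proof
      assume "w \<in> {x. 0 < \<phi> x} \<times> {x. 0 < u x}"
      then have w: "0 < \<phi> (fst w)" "0 < u (snd w)" by auto
      then have "?k w < ?g w" using ker_less[of "fst w" "snd w"] spow_pos
        by (intro mult_strict_left_mono) auto
      then show False using elim by simp
    qed
  qed
  moreover have "open {x. 0 < \<phi> x}"
  proof -
    have "continuous_on UNIV \<phi>" unfolding \<phi>_def
      by (intro continuous_on_compose2[OF cont] continuous_intros) auto
    then show ?thesis by (intro open_Collect_less continuous_on_const)
  qed
  ultimately have empty: "{x. 0 < \<phi> x} \<times> {x. 0 < u x} = {}"
    using open_pos by (intro AE_open_imp_empty open_Times)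
  have "\<phi> (z + (1 / m) *\<^sub>R x1) = u x1"
    using m by (simp add: \<phi>_def algebra_simps)
  with x1 have "(z + (1 / m) *\<^sub>R x1, x1) \<in> {x. 0 < \<phi> x} \<times> {x. 0 < u x}" by simp
  then show False unfolding empty by simp
qed

section \<open>Moving the plane to the centre\<close>

text \<open>
  The infimum of the levels above which all gaps are nonpositive has the same property by continuity.
  Above the support of \<open>u\<close> it holds trivially. A positive infimum contradicts one of the two lemmas
  \<open>plane_moves_past\<close> and \<open>not_symmetric_about_positive\<close>, unless \<open>u\<close> is zero.
\<close>

lemma gap_0_nonpos:
  assumes "0 < x \<bullet> e"
  shows "gap 0 x \<le> 0"
proof -
  define P where "P = {l. 0 \<le> l \<and> (\<forall>\<mu> x. l \<le> \<mu> \<longrightarrow> \<mu> < x \<bullet> e \<longrightarrow> gap \<mu> x \<le> 0)}"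
  have far: "\<bar>R\<bar> \<in> P"
  proof -
    have "gap \<mu> x \<le> 0" if "\<bar>R\<bar> \<le> \<mu>" "\<mu> < x \<bullet> e" for \<mu> x
    proof -
      have "x \<bullet> e \<le> norm x" using Cauchy_Schwarz_ineq2[of x e] e1 by simp
      then have "u x = 0" using that by (intro supp) linarith
      then show ?thesis using range[of "mirror e \<mu> x"] by (simp add: mirror_gap_def)
    qed
    then show ?thesis by (simp add: P_def)
  qed
  have bdd: "bdd_below P" by (rule bdd_belowI[of _ 0]) (simp add: P_def)
  define l where "l = Inf P"
  have ne: "P \<noteq> {}" using far by blast
  have l0: "0 \<le> l" unfolding l_def by (rule cInf_greatest[OF ne]) (simp add: P_def)
  have above: "gap \<mu> x \<le> 0" if \<mu>: "l < \<mu>" "\<mu> < x \<bullet> e" for \<mu> x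
  proof -
    obtain k where "k \<in> P" "k < \<mu>" using cInf_less_iff[OF ne bdd, of \<mu>] \<mu>(1) unfolding l_def by blast
    then show ?thesis using \<mu> by (auto simp: P_def)
  qed
  have at: "gap l x \<le> 0" if x: "l < x \<bullet> e" for x
  proof -
    have "((\<lambda>\<mu>. gap \<mu> x) \<longlongrightarrow> gap l x) (at_right l)"
    proof -
      have "continuous_on UNIV (\<lambda>\<mu>. mirror e \<mu> x)" unfolding mirror_def by (intro continuous_intros)
      then have "continuous_on UNIV (\<lambda>\<mu>. gap \<mu> x)" unfolding mirror_gap_def
        by (intro continuous_on_diff continuous_on_const continuous_on_compose2[OF cont]) auto
      then have "isCont (\<lambda>\<mu>. gap \<mu> x) l" by (simp add: continuous_on_eq_continuous_at)
      then have "((\<lambda>\<mu>. gap \<mu> x) \<longlongrightarrow> gap l x) (at l)" by (simp add: isCont_def)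
      then show ?thesis by (rule tendsto_within_subset) simp
    qed
    moreover have "\<forall>\<^sub>F \<mu> in at_right l. gap \<mu> x \<le> 0"
      using eventually_at_right_real[OF x] by eventually_elim (auto intro: above)
    ultimately show ?thesis by (rule tendsto_upperbound) simp
  qed
  show ?thesis
  proof (cases "l = 0")
    case True
    then show ?thesis using at assms by simp
  next
    case False
    then have l: "0 < l" using l0 by simp
    show ?thesis
    proof (cases "\<exists>y0. l < y0 \<bullet> e \<and> gap l y0 < 0")
      case True
      then obtain y0 where y0: "l < y0 \<bullet> e" "gap l y0 < 0" by blast
      obtain \<epsilon> where \<epsilon>: "0 < \<epsilon>"
        and past: "\<And>\<mu> x. 0 \<le> \<mu> \<Longrightarrow> l - \<epsilon> \<le> \<mu> \<Longrightarrow> \<mu> \<le> l \<Longrightarrow> \<mu> < x \<bullet> e \<Longrightarrow> gap \<mu> x \<le> 0"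
        using plane_moves_past[OF l at y0] by blast
      have "max (l - \<epsilon>) 0 \<in> P"
        unfolding P_def using past above by (force simp: not_le)
      then have "l \<le> max (l - \<epsilon>) 0" unfolding l_def by (rule cInf_lower[OF _ bdd])
      then show ?thesis using \<epsilon> l by (auto simp: max_def split: if_splits)
    next
      case False
      have "gap l y = 0" if "l < y \<bullet> e" for y
        using at[OF that] False that by force
      then have "u y = 0" for y by (rule not_symmetric_about_positive[OF l])
      then show ?thesis by (simp add: mirror_gap_def)
    qed
  qed
qed

end

section \<open>Symmetry of the solution\<close>

lemma refl_coord_eq_mirror: "refl_coord k x = mirror (axis k 1) 0 x"
  by (simp add: vec_eq_iff refl_coord_def mirror_def inner_axis) (simp add: axis_def)

text \<open>
  The mirror image in a hyperplane between \<open>x\<close> and the centre lies on the segment from \<open>x\<close> to its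
  reflection in the central hyperplane.
\<close>

lemma fold_into_domain:
  fixes \<Omega> :: "(real ^ 'n::finite) set"
  assumes conv: "convex_in_direction k \<Omega>" and sym: "refl_coord k ` \<Omega> = \<Omega>"
    and e: "e = axis k 1 \<or> e = - axis k 1"
    and x: "x \<in> \<Omega>" and l: "0 \<le> l" "l \<le> x \<bullet> e"
  shows "mirror e l x \<in> \<Omega>"
proof -
  have refl: "refl_coord k x \<in> \<Omega>" using sym x by blast
  have eq: "refl_coord k x = x - (2 * (x \<bullet> e)) *\<^sub>R e"
    using e by (auto simp: refl_coord_eq_mirror mirror_def)
  have "\<forall>i. i \<noteq> k \<longrightarrow> x $ i = refl_coord k x $ i" by (simp add: refl_coord_def)
  with conv x refl have seg: "closed_segment x (refl_coord k x) \<subseteq> \<Omega>"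
    unfolding convex_in_direction_def by blast
  have "mirror e l x \<in> closed_segment x (refl_coord k x)"
  proof (cases "x \<bullet> e = 0")
    case True
    then show ?thesis using l by (simp add: mirror_def)
  next
    case False
    define t where "t = (x \<bullet> e - l) / (x \<bullet> e)"
    have "0 \<le> t" "t \<le> 1" using False l by (auto simp: t_def field_simps)
    moreover have "mirror e l x = (1 - t) *\<^sub>R x + t *\<^sub>R refl_coord k x"
    proof -
      have "(1 - t) *\<^sub>R x + t *\<^sub>R refl_coord k x = x - (2 * (t * (x \<bullet> e))) *\<^sub>R e"
        unfolding eq by (simp add: algebra_simps)
      also have "t * (x \<bullet> e) = x \<bullet> e - l" using False by (simp add: t_def)
      finally show ?thesis by (simp add: mirror_def)
    qed
    ultimately show ?thesis by (auto simp: closed_segment_def)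
  qed
  then show ?thesis using seg by blast
qed

text \<open>
  Inside the closure of \<open>\<Omega>\<close>, \<open>u\<close> need not vanish at every point off \<open>\<Omega>\<close>; outside a large ball, which is
  open, it must.
\<close>

lemma vanishes_far_away:
  fixes u :: "real ^ 'n::finite \<Rightarrow> real"
  assumes "bounded \<Omega>" and cont: "continuous_on UNIV u" and u: "AE x in lborel. x \<notin> \<Omega> \<longrightarrow> u x = 0"
  obtains R where "\<And>x. R < norm x \<Longrightarrow> u x = 0"
proof -
  obtain R where R: "\<And>x. x \<in> \<Omega> \<Longrightarrow> norm x \<le> R" using assms(1) by (auto simp: bounded_iff)
  let ?S = "{x. u x \<noteq> 0} \<inter> {x. R < norm x}"
  have "open {x. u x \<noteq> 0}" by (intro open_Collect_neq cont continuous_on_const)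
  moreover have "open {x :: real ^ 'n. R < norm x}" by (intro open_Collect_less continuous_intros)
  moreover have "AE x in lborel. x \<notin> ?S"
    using u by eventually_elim (use R in force)
  ultimately have "?S = {}" by (intro AE_open_imp_empty open_Int)
  then show ?thesis by (intro that[of R]) blast
qed

theorem theorem1p5:
  fixes k :: "'n::finite" and s p :: real and \<Omega> :: "(real ^ 'n) set"
    and f :: "real \<Rightarrow> real" and u :: "real ^ 'n \<Rightarrow> real"
  assumes "0 < s" and "s < 1 / 2" and "1 / (1 - s) < p" and "p < 2"
    and "bounded \<Omega>" and "open \<Omega>"
    and "convex_in_direction k \<Omega>" and "refl_coord k ` \<Omega> = \<Omega>"
    and "locally_lipschitz f"
    and "continuous_on UNIV u"
    and "\<forall>x. 0 \<le> u x"
    and "weak_solution s p \<Omega> f u"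
  shows "\<forall>x. u (refl_coord k x) = u x"
proof -
  have "1 < 1 / (1 - s)" using assms by (simp add: field_simps)
  then have p1: "1 < p" using assms by linarith
  have [measurable]: "u \<in> borel_measurable borel"
    by (rule borel_measurable_continuous_onI[OF assms(10)])
  have "AE x in lborel. x \<notin> \<Omega> \<longrightarrow> u x = 0"
    using assms(12) unfolding weak_solution_def by (simp add: Wsp0_iff)
  then obtain R where R: "\<And>x. R < norm x \<Longrightarrow> u x = 0"
    using vanishes_far_away[OF assms(5,10)] by blast
  have "compact (u ` cball 0 R)"
    by (intro compact_continuous_image continuous_on_subset[OF assms(10)]) auto
  then have "bounded (u ` cball 0 R)" by (rule compact_imp_bounded)
  then obtain B where B: "\<And>x. norm x \<le> R \<Longrightarrow> norm (u x) \<le> B"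
    unfolding bounded_iff by (metis imageI mem_cball_0)
  \<comment> \<open>the summand 1 keeps the bound positive when \<open>u = 0\<close>\<close>
  define M where "M = \<bar>B\<bar> + 1"
  have range: "u x \<in> {0..M}" for x
    using assms(11) B[of x] R[of x] by (cases "norm x \<le> R") (auto simp: M_def)
  have loc: "local_lipschitz (UNIV :: real set) UNIV (\<lambda>_. f)"
    using assms(9) by (simp add: locally_lipschitz_def)
  have "local_lipschitz {0 :: real} {0..M} (\<lambda>_. f)"
    by (rule local_lipschitz_subset[OF loc]) auto
  then obtain K where "\<And>t :: real. t \<in> {0} \<Longrightarrow> K-lipschitz_on {0..M} f"
    using local_lipschitz_compact_implies_lipschitz[of "{0 :: real}" "{0..M}" "\<lambda>_. f"]
    by (metis compact_Icc compact_sing continuous_on_const)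
  then have lip: "(\<bar>K\<bar> + 1)-lipschitz_on {0..M} f" by (auto intro: lipschitz_on_le)
  have "continuous_on UNIV f"
    using local_lipschitz_continuous_on[OF loc, of 0] by simp
  then have f_borel: "f \<in> borel_measurable borel" by (rule borel_measurable_continuous_onI)
  have half: "u x \<le> u (mirror e 0 x)" if e: "e = axis k 1 \<or> e = - axis k 1" and x: "0 < x \<bullet> e" for e x
  proof -
    have "moving_plane s p M R (\<bar>K\<bar> + 1) \<Omega> f u e"
    proof
      show "e \<in> Basis \<or> - e \<in> Basis" using e by (auto simp: axis_in_Basis_iff Basis_real_def)
      show "mirror e l x \<in> \<Omega>" if "x \<in> \<Omega>" "0 \<le> l" "l \<le> x \<bullet> e" for x l
        using fold_into_domain[OF assms(7,8) e that] .
      show "0 < M" by (simp add: M_def)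
    qed (use assms p1 lip f_borel range R in auto)
    from moving_plane.gap_0_nonpos[OF this x] show ?thesis by (simp add: mirror_gap_def)
  qed
  have refl: "refl_coord k x = mirror (axis k 1) 0 x" "refl_coord k x = mirror (- axis k 1) 0 x" for x
    by (simp_all add: refl_coord_eq_mirror mirror_def)
  have le: "u x \<le> u (refl_coord k x)" for x
  proof -
    consider "0 < x \<bullet> axis k 1" | "0 < x \<bullet> (- axis k 1)" | "x \<bullet> axis k 1 = 0" by force
    then show ?thesis
    proof cases
      case 1 then show ?thesis using half[of "axis k 1" x] refl(1) by simp
    next
      case 2 then show ?thesis using half[of "- axis k 1" x] refl(2) by simp
    next
      case 3 then show ?thesis by (simp add: refl(1) mirror_def)
    qed
  qed
  have "refl_coord k (refl_coord k x) = x" for x by (simp add: refl_coord_def vec_eq_iff)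
  then show ?thesis using le by (metis antisym)
qed

end
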